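(* Let $H$ be a connected graph with a gluing $\varphi:U_1\to U_2$ (a bijection between two disjoint non-empty sets $U_1,U_2$ of vertices of $H$), and let $\mathcal G(H,\varphi)=(G_n)_{n\ge1}$ be the associated $H$-linear family. Then the generating function $F_{\mathcal G}(t,x)=\sum_{n\ge1}t^n\,\Gamma_{G_n}(x)$ is a rational fraction in $t,x$ with integer coefficients. The same holds for the generating function $F_{\mathcal G^\circ}(t,x)=\sum_{n\ge1}t^n\,\Gamma_{G^\circ_n}(x)$ of the associated $H$-circular family $\mathcal G^\circ(H,\varphi)=(G^\circ_n)_{n\ge1}$.
   Context: Graphs are finite, with loops and multiple edges allowed. For graphs $H_1,H_2$ and a bijection $\psi$ from a non-empty set of vertices of $H_1$ to a set of vertices of $H_2$ (a gluing), the vertex-amalgamation $H_1\circledast_\psi H_2$ is obtained from the disjoint union of $H_1$ and $H_2$ by identifying $u$ with $\psi(u)$ for every $u$ in the domain of $\psi$ (edges are kept). Likewise, the self-amalgamation of a graph along a bijection $\psi$ between two disjoint non-empty sets of its vertices identifies $u$ with $\psi(u)$ for all $u$. $H$-linear family: $G_1=H$, and $G_{n+1}$ is the vertex-amalgamation of $G_n$ with a new copy of $H$, where the vertices of $U_1$ in the last added copy of $H$ in $G_n$ (those not yet identified) are identified via $\varphi$ with the vertices of $U_2$ in the new copy. $H$-circular family: $G_n^\circ$ is the self-amalgamation of $G_n$ identifying via $\varphi$ the not yet identified vertices of $U_1$ (in the last copy of $H$) with the not yet identified vertices of $U_2$ (in the first copy of $H$). Genus polynomial: $\Gamma_G(x)=\sum_{i\ge0}\gamma_i(G)x^i$,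 where $\gamma_i(G)$ is the number of orientable cellular embeddings of the connected graph $G$ of genus $i$, embeddings being counted as rotation systems (a choice of cyclic order of the edge-ends around each vertex), with genus $i$ given by $|V|-|E|+\#\text{faces}=2-2i$. *)

theory Defs
  imports
    "Graph_Theory.Digraph_Component"
    "HOL-Combinatorics.Orbits"
    "HOL-Computational_Algebra.Polynomial_FPS"
begin

text \<open>
  A finite graph with loops and multiple edges is given by a \<^locale>\<open>fin_digraph\<close>: every arc stands
  for one undirected edge. Its direction is arbitrary and serves only to tell apart the two ends of
  the edge, in particular of a loop. Accordingly, connectedness is
  \<^const>\<open>Digraph_Component.connected\<close>, which ignores directions.
\<close>

section \<open>Rotation systems and the genus polynomial\<close>

definition edge_ends :: "('v, 'e) pre_digraph \<Rightarrow> ('e \<times> bool) set" where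
  "edge_ends G = arcs G \<times> UNIV"

definition end_vertex :: "('v, 'e) pre_digraph \<Rightarrow> 'e \<times> bool \<Rightarrow> 'v" where
  "end_vertex G d = (if snd d then head G (fst d) else tail G (fst d))"

definition ends_at :: "('v, 'e) pre_digraph \<Rightarrow> 'v \<Rightarrow> ('e \<times> bool) set" where
  "ends_at G v = {d \<in> edge_ends G. end_vertex G d = v}"

definition other_end :: "'e \<times> bool \<Rightarrow> 'e \<times> bool" where
  "other_end d = (fst d, \<not> snd d)"

definition rotation_system :: "('v, 'e) pre_digraph \<Rightarrow> ('e \<times> bool \<Rightarrow> 'e \<times> bool) \<Rightarrow> bool" where
  "rotation_system G \<rho> \<longleftrightarrow>
     \<rho> permutes edge_ends G \<and>
     (\<forall>v \<in> verts G. ends_at G v \<noteq> {} \<longrightarrow> cyclic_on \<rho> (ends_at G v))"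

text \<open>
  Faces are traced by walking along an edge to its other end and then turning to the next edge-end
  at that vertex. An isolated vertex lies in a sphere of its own and contributes one face, which
  face tracing does not see.
\<close>
definition num_faces :: "('v, 'e) pre_digraph \<Rightarrow> ('e \<times> bool \<Rightarrow> 'e \<times> bool) \<Rightarrow> nat" where
  "num_faces G \<rho> =
     card (orbit (\<rho> \<circ> other_end) ` edge_ends G) + card {v \<in> verts G. ends_at G v = {}}"

definition genus_count :: "('v, 'e) pre_digraph \<Rightarrow> nat \<Rightarrow> nat" where
  "genus_count G i =
     card {\<rho>. rotation_system G \<rho> \<and>
              int (card (verts G)) - int (card (arcs G)) + int (num_faces G \<rho>) = 2 - 2 * int i}"

definition genus_poly :: "('v, 'e) pre_digraph \<Rightarrow> int poly" where
  "genus_poly G = (\<Sum>i \<in> {i. genus_count G i \<noteq> 0}. monom (int (genus_count G i)) i)"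

lemma finite_genus_support:
  assumes "finite (arcs G)"
  shows "finite {i. genus_count G i \<noteq> 0}"
proof -
  let ?R = "{\<rho>. rotation_system G \<rho>}"
  let ?g = "\<lambda>\<rho>. nat ((2 - (int (card (verts G)) - int (card (arcs G)) + int (num_faces G \<rho>))) div 2)"
  have "?R \<subseteq> {\<rho>. \<rho> permutes edge_ends G}"
    by (auto simp: rotation_system_def)
  moreover have "finite (edge_ends G)"
    using assms by (simp add: edge_ends_def)
  ultimately have fin: "finite ?R"
    using finite_permutations finite_subset by blast
  have "{i. genus_count G i \<noteq> 0} \<subseteq> ?g ` ?R"
  proof
    fix i assume "i \<in> {i. genus_count G i \<noteq> 0}"
    then have "{\<rho>. rotation_system G \<rho> \<and> int (card (verts G)) - int (card (arcs G)) +
        int (num_faces G \<rho>) = 2 - 2 * int i} \<noteq> {}"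
      unfolding genus_count_def by (metis (mono_tags, lifting) card.empty mem_Collect_eq)
    then obtain \<rho> where "rotation_system G \<rho>"
      "int (card (verts G)) - int (card (arcs G)) + int (num_faces G \<rho>) = 2 - 2 * int i"
      by blast
    then show "i \<in> ?g ` ?R"
      by (intro image_eqI[where x = \<rho>]) simp_all
  qed
  with fin show ?thesis
    using finite_subset by blast
qed

lemma coeff_genus_poly:
  assumes "finite (arcs G)"
  shows "coeff (genus_poly G) i = int (genus_count G i)"
  using finite_genus_support[OF assms]
  by (auto simp: genus_poly_def coeff_sum sum.delta)

section \<open>Amalgamations\<close>

text \<open>
  The identification of each \<open>u \<in> U\<close> with \<open>\<psi> u\<close> is realised by keeping \<open>u\<close> as the name of the merged
  vertex. This is the intended quotient whenever \<open>\<psi>\<close> is injective on \<open>U\<close> and \<open>U\<close> is disjoint from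
  \<open>\<psi> ` U\<close>.
\<close>
definition merged :: "'v set \<Rightarrow> ('v \<Rightarrow> 'v) \<Rightarrow> 'v \<Rightarrow> 'v" where
  "merged U \<psi> v = (if v \<in> \<psi> ` U then inv_into U \<psi> v else v)"

definition self_amalgamation ::
    "'v set \<Rightarrow> ('v \<Rightarrow> 'v) \<Rightarrow> ('v, 'e) pre_digraph \<Rightarrow> ('v, 'e) pre_digraph" where
  "self_amalgamation U \<psi> G =
     \<lparr>verts = merged U \<psi> ` verts G, arcs = arcs G,
      tail = merged U \<psi> \<circ> tail G, head = merged U \<psi> \<circ> head G\<rparr>"

text \<open>Meant for graphs that share neither vertices nor edges.\<close>
definition disjoint_union ::
    "('v, 'e) pre_digraph \<Rightarrow> ('v, 'e) pre_digraph \<Rightarrow> ('v, 'e) pre_digraph" where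
  "disjoint_union G K =
     \<lparr>verts = verts G \<union> verts K, arcs = arcs G \<union> arcs K,
      tail = (\<lambda>e. if e \<in> arcs G then tail G e else tail K e),
      head = (\<lambda>e. if e \<in> arcs G then head G e else head K e)\<rparr>"

definition vertex_amalgamation ::
    "'v set \<Rightarrow> ('v \<Rightarrow> 'v) \<Rightarrow> ('v, 'e) pre_digraph \<Rightarrow> ('v, 'e) pre_digraph \<Rightarrow> ('v, 'e) pre_digraph" where
  "vertex_amalgamation U \<psi> G K = self_amalgamation U \<psi> (disjoint_union G K)"

section \<open>Linear and circular families\<close>

definition graph_copy :: "nat \<Rightarrow> ('v, 'e) pre_digraph \<Rightarrow> (nat \<times> 'v, nat \<times> 'e) pre_digraph" where
  "graph_copy k H =
     \<lparr>verts = Pair k ` verts H, arcs = Pair k ` arcs H,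
      tail = (\<lambda>e. (k, tail H (snd e))), head = (\<lambda>e. (k, head H (snd e)))\<rparr>"

text \<open>
  The \<open>n\<close>-th graph consists of the copies \<open>1, \<dots>, n\<close> of \<open>H\<close>; the graph with index \<open>0\<close> is left
  unspecified. If \<open>U\<close> is disjoint from \<open>\<phi> ` U\<close>, then the vertices \<open>(n, u)\<close>, \<open>u \<in> U\<close>, of the last copy
  and the vertices \<open>(1, \<phi> u)\<close>, \<open>u \<in> U\<close>, of the first copy keep their names in the \<open>n\<close>-th graph.
\<close>
fun linear_family ::
    "('v, 'e) pre_digraph \<Rightarrow> 'v set \<Rightarrow> ('v \<Rightarrow> 'v) \<Rightarrow> nat \<Rightarrow> (nat \<times> 'v, nat \<times> 'e) pre_digraph" where
  "linear_family H U \<phi> (Suc 0) = graph_copy 1 H"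
| "linear_family H U \<phi> (Suc (Suc n)) =
     vertex_amalgamation (Pair (Suc n) ` U) (\<lambda>v. (Suc (Suc n), \<phi> (snd v)))
       (linear_family H U \<phi> (Suc n)) (graph_copy (Suc (Suc n)) H)"

definition circular_family ::
    "('v, 'e) pre_digraph \<Rightarrow> 'v set \<Rightarrow> ('v \<Rightarrow> 'v) \<Rightarrow> nat \<Rightarrow> (nat \<times> 'v, nat \<times> 'e) pre_digraph" where
  "circular_family H U \<phi> n =
     self_amalgamation (Pair n ` U) (\<lambda>v. (1, \<phi> (snd v))) (linear_family H U \<phi> n)"

section \<open>Generating functions\<close>

text \<open>Power series in \<open>t\<close> whose coefficients are polynomials in \<open>x\<close>.\<close>
definition genus_gf :: "(nat \<Rightarrow> ('v, 'e) pre_digraph) \<Rightarrow> int poly fps" where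
  "genus_gf G = Abs_fps (\<lambda>n. if n = 0 then 0 else genus_poly (G n))"

text \<open>\<open>F = P / Q\<close> in the field of fractions of the integral domain \<open>\<int>[x][[t]]\<close>, with \<open>P, Q \<in> \<int>[x][t]\<close>.\<close>
definition rational_fraction :: "int poly fps \<Rightarrow> bool" where
  "rational_fraction F \<longleftrightarrow>
     (\<exists>P Q :: int poly poly. Q \<noteq> 0 \<and> fps_of_poly Q * F = fps_of_poly P)"

end

theory Submission
  imports Defs
begin

text \<open>
  Write the length of a permutation for the number of points minus the number of cycles. For a
  connected graph, Euler's formula turns the genus of a rotation system into the length of its face
  permutation, so with \<open>x = y\<^sup>2\<close> the genus polynomial is, up to a power of \<open>y\<close>, the sum of
  \<open>y\<close> to these lengths.

  Cut the \<open>n\<close>-th graph open at the gluing vertices of its first and last copy and let a permutation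
  \<open>\<kappa>\<close> of the finitely many edge-ends there take the place of the missing rotation; this gives
  polynomials \<open>Z\<^sub>n(\<kappa>)\<close>. The genus polynomials of both families are sums of \<open>Z\<^sub>n(\<kappa>)\<close> over fixed
  sets of \<open>\<kappa>\<close>. Multiplying a permutation of a set \<open>A\<close> by one that moves points of \<open>X \<subseteq> A\<close> and new
  points has, up to a constant shift of the length, the same effect as multiplying by a suitable
  permutation of \<open>X\<close> alone. Hence adding a copy of \<open>H\<close> expresses \<open>Z\<^sub>n\<^sub>+\<^sub>1\<close> through \<open>Z\<^sub>n\<close> by a matrix
  over \<open>\<int>[y]\<close> that does not depend on \<open>n\<close>, and linear dependence among its powers yields the
  recurrence.
\<close>

section \<open>Cycles and Euler's formula\<close>

text \<open>A vertex still to be glued has no rotation of its own yet: old and new edge-ends will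
  alternate around it in arbitrary ways. So its ends stay without a rotation until all of them are
  present. Eliminating the new points from a product leaves an arbitrary permutation of the open
  ends, not a rotation. The states are therefore all permutations of \<open>open_ends\<close>,
  although the final sums only use special ones. Lengths are preferred to cycle counts because
  eliminating a point lowers the length by 0 or 1 and never raises it, so the matrix entries are
  honest polynomials. The variable \<open>y\<close> cannot be avoided: twice the genus enters the
  length, but single eliminations shift it by one, that is, by half a power of \<open>x\<close>. The
  recurrence found over the integers in \<open>y\<close> must then be brought back to
  \<open>x = y^2\<close>. All linear algebra is done without division, so coefficients stay
  integral.\<close>

definition num_cycles :: "'a set \<Rightarrow> ('a \<Rightarrow> 'a) \<Rightarrow> nat" where
  "num_cycles A p = card (orbit p ` A)"

lemma permutes_self_in_orbit:
  assumes "p permutes A" "finite A"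
  shows "x \<in> orbit p x"
  using assms permutation_self_in_orbit permutation_permutes by metis

lemma permutes_orbit_eq_iff:
  assumes "p permutes A" "finite A"
  shows "orbit p x = orbit p y \<longleftrightarrow> x \<in> orbit p y"
  using assms permutes_self_in_orbit[OF assms] cyclic_on_orbit[OF assms] orbit_cyclic_eq3 by metis

lemma num_cycles_cong:
  assumes "A = B" "\<And>x. x \<in> A \<Longrightarrow> p x = q x" "p ` A \<subseteq> A"
  shows "num_cycles A p = num_cycles B q"
proof -
  have "orbit p x = orbit q x" if "x \<in> A" for x
    by (rule orbit_cong0[where A = A]) (use assms that in auto)
  then show ?thesis
    unfolding num_cycles_def using assms(1) by (metis image_cong)
qed

lemma num_cycles_le_card: "finite A \<Longrightarrow> num_cycles A p \<le> card A"
  unfolding num_cycles_def by (rule card_image_le)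

lemma num_cycles_insert_fixed:
  assumes "p permutes A" "finite A" "b \<notin> A"
  shows "num_cycles (insert b A) p = Suc (num_cycles A p)"
proof -
  have "p b = b"
    using assms by (simp add: permutes_not_in)
  then have b: "orbit p b = {b}"
    by (simp add: orbit_eq_singleton_iff)
  have "{b} \<notin> orbit p ` A"
    using permutes_orbit_subset[OF assms(1)] assms(3) by blast
  with b assms(2) show ?thesis
    by (simp add: num_cycles_def)
qed

text \<open>The product differs from \<open>p\<close> only in that the images of \<open>a\<close>
  and \<open>b\<close> are exchanged: leaving \<open>a\<close> it runs through the cycle of
  \<open>b\<close>, and leaving \<open>b\<close> it runs through the cycle of \<open>a\<close>.
  Cycles through neither point survive.\<close>

lemma num_cycles_merge:
  assumes p: "p permutes A" and fin: "finite A" and "a \<in> A" "b \<in> A" and sep: "b \<notin> orbit p a"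
  shows "Suc (num_cycles A (p \<circ> Transposition.transpose a b)) = num_cycles A p"
proof -
  define q where "q = p \<circ> Transposition.transpose a b"
  have q: "q permutes A"
    unfolding q_def using assms by (intro permutes_compose permutes_swap_id)
  have sep': "a \<notin> orbit p b"
    using sep permutes_orbit_eq_iff[OF p fin] permutes_self_in_orbit[OF p fin] by metis
  have ne: "a \<noteq> b"
    using sep permutes_self_in_orbit[OF p fin] by metis
  have qa: "q a = p b" and qb: "q b = p a" and qo: "\<And>x. x \<noteq> a \<Longrightarrow> x \<noteq> b \<Longrightarrow> q x = p x"
    by (auto simp: q_def)
  have pb: "x \<in> orbit q a" if "x \<in> orbit p b" for x
    using that
  proof induction
    case base
    then show ?case using qa orbit.base by metis
  next
    case (step y)
    then show ?case
      by (metis qa qo sep' orbit.base orbit.step)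
  qed
  then have b_in: "b \<in> orbit q a"
    using permutes_self_in_orbit[OF p fin] by blast
  have pa: "x \<in> orbit q a" if "x \<in> orbit p a" for x
    using that
  proof induction
    case base
    then show ?case using qb b_in orbit.step by metis
  next
    case (step y)
    then show ?case
      by (metis qb qo sep b_in orbit.step)
  qed
  define T where "T = orbit p a \<union> orbit p b"
  have "orbit q a \<subseteq> T"
  proof
    fix x assume "x \<in> orbit q a"
    then show "x \<in> T"
    proof induction
      case base
      then show ?case by (auto simp: qa T_def intro: orbit.intros)
    next
      case (step y)
      then show ?case
        by (cases "y = a \<or> y = b") (auto simp: qa qb qo T_def intro: orbit.intros)
    qed
  qed
  with pa pb have T: "orbit q a = T"
    unfolding T_def by blast
  have T_orbit: "orbit q x = T" if "x \<in> T" for x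
    using permutes_orbit_eq_iff[OF q fin] that T by metis
  have other: "orbit q x = orbit p x" if "x \<notin> T" for x
  proof (rule orbit_cong[OF permutes_self_in_orbit[OF p fin]])
    fix s assume s: "s \<in> orbit p x"
    have "a \<notin> orbit p x" "b \<notin> orbit p x"
      using that unfolding T_def using permutes_orbit_eq_iff[OF p fin]
      by (metis UnCI permutes_self_in_orbit[OF p fin])+
    with s show "q s = p s"
      by (intro qo) auto
  qed
  have TA: "T \<subseteq> A"
    unfolding T_def using permutes_orbit_subset[OF p] assms by blast
  have aT: "a \<in> T" "b \<in> T"
    unfolding T_def using permutes_self_in_orbit[OF p fin] by auto
  have "orbit q ` A = insert T (orbit p ` (A - T))"
  proof -
    have "orbit q ` (A - T) = orbit p ` (A - T)"
      using other by (intro image_cong) auto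
    moreover have "orbit q ` T = {T}"
      using T_orbit aT by auto
    moreover have "A = T \<union> (A - T)"
      using TA by blast
    ultimately show ?thesis
      by (metis image_Un insert_is_Un)
  qed
  moreover have "T \<notin> orbit p ` (A - T)"
    using permutes_self_in_orbit[OF p fin] by blast
  moreover have "orbit p ` A = insert (orbit p a) (insert (orbit p b) (orbit p ` (A - T)))"
  proof -
    have "orbit p x = orbit p a \<or> orbit p x = orbit p b" if "x \<in> T" for x
      using that permutes_orbit_eq_iff[OF p fin] unfolding T_def by blast
    then show ?thesis
      using assms(3,4) by blast
  qed
  moreover have "orbit p a \<notin> orbit p ` (A - T)" "orbit p b \<notin> orbit p ` (A - T)"
    using permutes_self_in_orbit[OF p fin] unfolding T_def by blast+
  moreover have "orbit p a \<noteq> orbit p b"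
    using sep permutes_self_in_orbit[OF p fin] by blast
  ultimately show ?thesis
    using fin by (simp add: num_cycles_def q_def[symmetric])
qed

text \<open>Multiplying by the same transposition again gives back \<open>p\<close>, so it suffices
  that \<open>q\<close> separates \<open>a\<close> from \<open>b\<close>; the count is then
  \<open>num_cycles_merge\<close> read backwards.\<close>

lemma num_cycles_split:
  assumes p: "p permutes A" and fin: "finite A" and "a \<in> A" "b \<in> A" "a \<noteq> b" and cyc: "b \<in> orbit p a"
  shows "num_cycles A (p \<circ> Transposition.transpose a b) = Suc (num_cycles A p)"
proof -
  define q where "q = p \<circ> Transposition.transpose a b"
  have q: "q permutes A"
    unfolding q_def using assms by (intro permutes_compose permutes_swap_id)
  define m where "m = (LEAST m. (p ^^ m) a = b)"
  have ex: "\<exists>m. (p ^^ m) a = b"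
    using cyc by (auto simp: orbit_altdef)
  have m: "(p ^^ m) a = b"
    unfolding m_def using ex by (rule LeastI_ex)
  have least: "(p ^^ j) a \<noteq> b" if "j < m" for j
    using that not_less_Least unfolding m_def by blast
  \<comment> \<open>\<open>T\<close> is the arc from \<open>p a\<close> to the first occurrence of
    \<open>b\<close>. Since \<open>q b = p a\<close>, it is closed under \<open>q\<close>, and
    minimality of \<open>m\<close> keeps \<open>a\<close> out of it.\<close>
  define T where "T = (\<lambda>j. (p ^^ j) a) ` {1..m}"
  have m0: "m > 0"
    using m \<open>a \<noteq> b\<close> by (cases m) auto
  have "a \<notin> T"
  proof
    assume "a \<in> T"
    then obtain j where j: "1 \<le> j" "j \<le> m" "(p ^^ j) a = a"
      unfolding T_def by auto
    have "(p ^^ (m - j)) ((p ^^ j) a) = b"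
      using j m by (metis comp_apply funpow_add le_add_diff_inverse2)
    then show False
      using j least[of "m - j"] m0 by simp
  qed
  have qT: "q x \<in> T" if x: "x \<in> T" for x
  proof (cases "x = b")
    case True
    then have "q x = (p ^^ 1) a"
      by (simp add: q_def)
    then show ?thesis
      unfolding T_def using m0 by (intro image_eqI) auto
  next
    case False
    obtain j where j: "1 \<le> j" "j \<le> m" "x = (p ^^ j) a"
      using x unfolding T_def by auto
    have "q x = (p ^^ Suc j) a"
      using x False \<open>a \<notin> T\<close> j by (auto simp: q_def Transposition.transpose_def)
    moreover have "j \<noteq> m"
      using False j m by auto
    ultimately show ?thesis
      unfolding T_def using j by (intro image_eqI[of _ _ "Suc j"]) auto
  qed
  have bT: "b \<in> T"
    unfolding T_def using m m0 by (intro image_eqI[of _ _ m]) auto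
  have "orbit q b \<subseteq> T"
  proof
    fix x assume "x \<in> orbit q b"
    then show "x \<in> T"
      by induction (auto intro: qT bT)
  qed
  then have "a \<notin> orbit q b"
    using \<open>a \<notin> T\<close> by blast
  then have "Suc (num_cycles A (q \<circ> Transposition.transpose b a)) = num_cycles A q"
    using num_cycles_merge[OF q fin] assms by blast
  moreover have "q \<circ> Transposition.transpose b a = p"
    by (simp add: q_def comp_assoc transpose_commute[of b a])
  ultimately show ?thesis
    by (simp add: q_def)
qed

text \<open>The new point is inserted just before \<open>a\<close> in its cycle. Moved to the right
  of \<open>p\<close>, the transposition becomes that of \<open>b\<close> and the preimage
  \<open>a'\<close> of \<open>a\<close>; it merges the fixed point \<open>b\<close> into a cycle and
  so cancels the cycle gained by adding \<open>b\<close>.\<close>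

lemma num_cycles_absorb_fixed:
  assumes p: "p permutes A" and fin: "finite A" and "a \<in> A" "b \<notin> A"
  shows "num_cycles (insert b A) (Transposition.transpose b a \<circ> p) = num_cycles A p"
proof -
  define a' where "a' = inv p a"
  have a': "a' \<in> A" "p a' = a"
    using p \<open>a \<in> A\<close> by (auto simp: a'_def permutes_inverses permutes_inv permutes_in_image)
  have p': "p permutes insert b A"
    using p permutes_subset by blast
  have pb: "p b = b"
    using p assms by (simp add: permutes_not_in)
  have "Transposition.transpose b a \<circ> p = p \<circ> Transposition.transpose a' b"
  proof
    fix x
    have "p x = b \<longleftrightarrow> x = b" "p x = a \<longleftrightarrow> x = a'"
      using a' pb permutes_inj[OF p] by (metis injD)+
    then show "(Transposition.transpose b a \<circ> p) x = (p \<circ> Transposition.transpose a' b) x"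
      using a' pb by (auto simp: Transposition.transpose_def)
  qed
  moreover have "Suc (num_cycles (insert b A) (p \<circ> Transposition.transpose a' b)) = num_cycles (insert b A) p"
    using permutes_orbit_subset[OF p a'(1)] assms a' p' by (intro num_cycles_merge) auto
  ultimately show ?thesis
    using num_cycles_insert_fixed[OF p fin \<open>b \<notin> A\<close>] by simp
qed

text \<open>Contract an edge that joins two cycles of \<open>\<rho>\<close>, or else delete an edge.\<close>
lemma euler_genus:
  fixes E :: "'e set"
  assumes "finite E" "S \<subseteq> E" "\<rho> permutes E \<times> UNIV" "E \<noteq> {}"
    and trans: "\<And>T. T \<subseteq> E \<times> UNIV \<Longrightarrow> T \<noteq> {} \<Longrightarrow> \<rho> ` T \<subseteq> T \<Longrightarrow>
        (\<And>e s. e \<in> S \<Longrightarrow> (e, s) \<in> T \<Longrightarrow> (e, \<not> s) \<in> T) \<Longrightarrow> T = E \<times> UNIV"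
  shows "\<exists>g. int (num_cycles (E \<times> UNIV) \<rho>) - int (card S) +
      int (num_cycles (E \<times> UNIV) (\<rho> \<circ> (\<lambda>d. if fst d \<in> S then other_end d else d))) = 2 - 2 * int g"
proof -
  let ?D = "E \<times> (UNIV :: bool set)"
  \<comment> \<open>\<open>S\<close> holds the edges still present. The ends of removed edges remain
    as points of \<rho>, but the involution fixes them.\<close>
  let ?\<alpha> = "\<lambda>S d. if fst d \<in> S then other_end d else d"
  have "finite ?D"
    using assms by simp
  have "finite S"
    using assms finite_subset by blast
  then show ?thesis
    using \<open>S \<subseteq> E\<close> assms(3) trans
  proof (induction S arbitrary: \<rho>)
    case empty
    \<comment> \<open>Without edges, transitivity leaves a single cycle: one vertex, one face, genus
      0.\<close>
    have "orbit \<rho> x = ?D" if x: "x \<in> ?D" for x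
    proof (rule empty.prems(3))
      show "orbit \<rho> x \<subseteq> ?D"
        using permutes_orbit_subset[OF empty.prems(2) x] .
      show "orbit \<rho> x \<noteq> {}" by (rule orbit_nonempty)
      show "\<rho> ` orbit \<rho> x \<subseteq> orbit \<rho> x" by (auto intro: orbit.step)
    qed simp
    moreover have "?D \<noteq> {}"
      using \<open>E \<noteq> {}\<close> by auto
    ultimately have "orbit \<rho> ` ?D = {?D}"
      by blast
    then have "num_cycles ?D \<rho> = 1"
      by (simp add: num_cycles_def)
    moreover have "\<rho> \<circ> ?\<alpha> {} = \<rho>"
      by auto
    ultimately show ?case
      by (intro exI[of _ 0]) simp
  next
    case (insert e S)
    define \<tau> where "\<tau> = Transposition.transpose (e, False) (e, True)"
    have eD: "(e, s) \<in> ?D" for s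
      using insert.prems by auto
    have \<tau>: "\<tau> permutes ?D"
      unfolding \<tau>_def using eD by (intro permutes_swap_id)
    have \<tau>_other: "\<tau> d = (if fst d = e then other_end d else d)" for d
      by (cases d) (auto simp: \<tau>_def other_end_def Transposition.transpose_def)
    have \<alpha>S: "?\<alpha> S permutes ?D"
    proof (rule bij_imp_permutes)
      show "bij_betw (?\<alpha> S) ?D ?D"
        by (rule bij_betw_byWitness[where f' = "?\<alpha> S"]) (use insert.prems in \<open>auto simp: other_end_def\<close>)
    qed (use insert.prems in auto)
    have \<alpha>1: "?\<alpha> (insert e S) = \<tau> \<circ> ?\<alpha> S" and \<alpha>2: "?\<alpha> (insert e S) = ?\<alpha> S \<circ> \<tau>"
      using \<open>e \<notin> S\<close> by (auto simp: fun_eq_iff \<tau>_other other_end_def)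
    show ?case
    proof (cases "(e, True) \<in> orbit \<rho> (e, False)")
      case False
      \<comment> \<open>Contraction: \<tau> merges the two vertices of \<open>e\<close>, so vertices
        and edges both drop by one, while the face permutation is literally unchanged.\<close>
      define \<rho>' where "\<rho>' = \<rho> \<circ> \<tau>"
      have \<rho>': "\<rho>' permutes ?D"
        unfolding \<rho>'_def using insert.prems \<tau> by (intro permutes_compose)
      have V: "Suc (num_cycles ?D \<rho>') = num_cycles ?D \<rho>"
        unfolding \<rho>'_def \<tau>_def using insert.prems(2) \<open>finite ?D\<close> eD eD False by (rule num_cycles_merge)
      have F: "\<rho> \<circ> ?\<alpha> (insert e S) = \<rho>' \<circ> ?\<alpha> S"
        unfolding \<alpha>1 by (simp only: \<rho>'_def comp_assoc)
      \<comment> \<open>Now both ends of \<open>e\<close> lie on one cycle of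
        \<open>\<rho>'\<close>, so a set closed under \<open>\<rho>'\<close> is closed under
        flipping \<open>e\<close> as well. This restores the transitivity hypothesis for
        \<open>insert.IH\<close>.\<close>
      have same: "(e, True) \<in> orbit \<rho>' (e, False)"
      proof (rule ccontr)
        assume "(e, True) \<notin> orbit \<rho>' (e, False)"
        then have "Suc (num_cycles ?D (\<rho>' \<circ> \<tau>)) = num_cycles ?D \<rho>'"
          unfolding \<tau>_def using \<rho>' \<open>finite ?D\<close> eD eD by (intro num_cycles_merge)
        moreover have "\<rho>' \<circ> \<tau> = \<rho>"
          by (simp add: \<rho>'_def \<tau>_def comp_assoc)
        ultimately show False using V by simp
      qed
      have "\<exists>g. int (num_cycles ?D \<rho>') - int (card S) + int (num_cycles ?D (\<rho>' \<circ> ?\<alpha> S)) = 2 - 2 * int g"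
      proof (rule insert.IH)
        fix T assume T: "T \<subseteq> ?D" "T \<noteq> {}" "\<rho>' ` T \<subseteq> T" "\<And>f s. f \<in> S \<Longrightarrow> (f, s) \<in> T \<Longrightarrow> (f, \<not> s) \<in> T"
        have orb: "orbit \<rho>' x \<subseteq> T" if "x \<in> T" for x
        proof
          fix y assume "y \<in> orbit \<rho>' x"
          then show "y \<in> T" by induction (use that T(3) in auto)
        qed
        have "(e, False) \<in> orbit \<rho>' (e, True)"
          using same permutes_orbit_eq_iff[OF \<rho>' \<open>finite ?D\<close>] permutes_self_in_orbit[OF \<rho>' \<open>finite ?D\<close>] by metis
        with orb same have e: "(e, \<not> s) \<in> T" if "(e, s) \<in> T" for s
          using that by (cases s) auto
        have "\<rho> x \<in> T" if "x \<in> T" for x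
        proof -
          have "\<tau> x \<in> T"
            using that e by (cases x) (auto simp: \<tau>_other other_end_def)
          moreover have "\<rho> x = \<rho>' (\<tau> x)"
            by (simp add: \<rho>'_def \<tau>_def)
          ultimately show ?thesis using T(3) by auto
        qed
        then show "T = ?D"
          using T e by (intro insert.prems(3)) auto
      qed (use insert.prems \<rho>' in auto)
      then obtain g where "int (num_cycles ?D \<rho>') - int (card S) + int (num_cycles ?D (\<rho>' \<circ> ?\<alpha> S)) = 2 - 2 * int g"
        by blast
      then show ?thesis
        unfolding F using V insert.hyps by (intro exI[of _ g]) (simp add: comp_def)
    next
      case True
      \<comment> \<open>Deletion of \<open>e\<close>, whose ends share a vertex: transitivity
        survives because a cycle of \<rho> already contains both ends. Putting \<open>e\<close> back
        either merges two faces, raising the genus by one, or splits a face and keeps the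
        genus.\<close>
      have "\<exists>g. int (num_cycles ?D \<rho>) - int (card S) + int (num_cycles ?D (\<rho> \<circ> ?\<alpha> S)) = 2 - 2 * int g"
      proof (rule insert.IH)
        fix T assume T: "T \<subseteq> ?D" "T \<noteq> {}" "\<rho> ` T \<subseteq> T" "\<And>f s. f \<in> S \<Longrightarrow> (f, s) \<in> T \<Longrightarrow> (f, \<not> s) \<in> T"
        have orb: "orbit \<rho> x \<subseteq> T" if "x \<in> T" for x
        proof
          fix y assume "y \<in> orbit \<rho> x"
          then show "y \<in> T" by induction (use that T(3) in auto)
        qed
        have "(e, False) \<in> orbit \<rho> (e, True)"
          using True permutes_orbit_eq_iff[OF insert.prems(2) \<open>finite ?D\<close>]
            permutes_self_in_orbit[OF insert.prems(2) \<open>finite ?D\<close>] by metis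
        with orb True have e: "(e, \<not> s) \<in> T" if "(e, s) \<in> T" for s
          using that by (cases s) auto
        show "T = ?D"
          using T e by (intro insert.prems(3)) auto
      qed (use insert.prems in auto)
      then obtain g where g: "int (num_cycles ?D \<rho>) - int (card S) + int (num_cycles ?D (\<rho> \<circ> ?\<alpha> S)) = 2 - 2 * int g"
        by blast
      define q where "q = \<rho> \<circ> ?\<alpha> S"
      have q: "q permutes ?D"
        unfolding q_def using insert.prems \<alpha>S by (intro permutes_compose)
      have F: "\<rho> \<circ> ?\<alpha> (insert e S) = q \<circ> \<tau>"
        unfolding \<alpha>2 by (simp only: q_def comp_assoc)
      have "Suc (num_cycles ?D (q \<circ> \<tau>)) = num_cycles ?D q \<or> num_cycles ?D (q \<circ> \<tau>) = Suc (num_cycles ?D q)"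
        unfolding \<tau>_def using num_cycles_merge[OF q \<open>finite ?D\<close> eD eD] num_cycles_split[OF q \<open>finite ?D\<close> eD eD]
        by blast
      then show ?thesis
      proof
        assume "Suc (num_cycles ?D (q \<circ> \<tau>)) = num_cycles ?D q"
        then show ?thesis
          unfolding F using g[folded q_def] insert.hyps by (intro exI[of _ "Suc g"]) (simp add: comp_def)
      next
        assume "num_cycles ?D (q \<circ> \<tau>) = Suc (num_cycles ?D q)"
        then show ?thesis
          unfolding F using g[folded q_def] insert.hyps by (intro exI[of _ g]) (simp add: comp_def)
      qed
    qed
  qed
qed

section \<open>Eliminating points from a product of permutations\<close>

text \<open>For a permutation of a finite \<open>A\<close> this is the least number of
  transpositions whose product is \<open>p\<close>, and the truncated subtraction is exact.\<close>

definition transposition_length :: "'a set \<Rightarrow> ('a \<Rightarrow> 'a) \<Rightarrow> nat" where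
  "transposition_length A p = card A - num_cycles A p"

lemma map_permutation_superset:
  assumes "p permutes A" "A \<subseteq> B" "inj_on f B"
  shows "map_permutation B f p = map_permutation A f p"
proof
  fix y
  have fA: "inj_on f A"
    using assms inj_on_subset by blast
  consider x where "x \<in> A" "y = f x" | x where "x \<in> B - A" "y = f x" | "y \<notin> f ` B"
    by blast
  then show "map_permutation B f p y = map_permutation A f p y"
  proof cases
    case 1
    then show ?thesis
      using assms fA by (simp add: map_permutation_apply subset_iff)
  next
    case 2
    then have "y \<notin> f ` A"
      using assms by (auto simp: inj_on_def)
    then show ?thesis
      using 2 assms by (simp add: map_permutation_apply permutes_not_in map_permutation_def[of A])
  next
    case 3
    then have "y \<notin> f ` A"
      using assms by blast
    with 3 show ?thesis
      by (simp add: map_permutation_def)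
  qed
qed

lemma map_permutation_permutes_image:
  assumes "inj_on f A" "p permutes A"
  shows "map_permutation A f p permutes f ` A"
  using assms by (intro map_permutation_permutes) (auto simp: bij_betw_def)

text \<open>The points of \<open>C\<close> are removed one at a time: a fixed point of \<open>\<theta>\<close> is dropped, any other point is
  first made a fixed point by a transposition.\<close>
lemma absorb_permutation:
  assumes "finite C" "finite X" "X \<inter> C = {}" "\<theta> permutes X \<union> C"
  shows "\<exists>\<theta>' m. \<theta>' permutes X \<and> (\<forall>(f :: 'a \<Rightarrow> 'b) A \<gamma>.
    inj_on f (X \<union> C) \<longrightarrow> finite A \<longrightarrow> A \<inter> f ` (X \<union> C) = f ` X \<longrightarrow> \<gamma> permutes A \<longrightarrow>
      transposition_length (A \<union> f ` C) (map_permutation (X \<union> C) f \<theta> \<circ> \<gamma>) =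
      transposition_length A (map_permutation X f \<theta>' \<circ> \<gamma>) + m)"
  using assms
proof (induction C arbitrary: \<theta>)
  case empty
  then show ?case
    by (intro exI[of _ \<theta>] exI[of _ 0]) simp
next
  case (insert b C)
  define \<theta>1 where "\<theta>1 = Transposition.transpose b (\<theta> b) \<circ> \<theta>"
  have "\<theta> permutes insert b (X \<union> C)"
    using insert.prems by simp
  then have \<theta>1: "\<theta>1 permutes X \<union> C"
    unfolding \<theta>1_def by (rule permutes_insert_lemma)
  have \<theta>_eq: "\<theta> = Transposition.transpose b (\<theta> b) \<circ> \<theta>1"
    by (simp add: \<theta>1_def comp_assoc[symmetric])
  have "X \<inter> C = {}"
    using insert.prems by auto
  from insert.IH[OF insert.prems(1) this \<theta>1]
  obtain \<theta>' m where \<theta>': "\<theta>' permutes X" and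
    m: "\<forall>(f :: 'a \<Rightarrow> 'b) A \<gamma>. inj_on f (X \<union> C) \<longrightarrow> finite A \<longrightarrow> A \<inter> f ` (X \<union> C) = f ` X \<longrightarrow> \<gamma> permutes A \<longrightarrow>
      transposition_length (A \<union> f ` C) (map_permutation (X \<union> C) f \<theta>1 \<circ> \<gamma>) =
      transposition_length A (map_permutation X f \<theta>' \<circ> \<gamma>) + m"
    by (elim exE conjE) (rule that)
  have b: "b \<notin> X \<union> C"
    using insert by auto
  have step: "transposition_length (A \<union> f ` insert b C) (map_permutation (X \<union> insert b C) f \<theta> \<circ> \<gamma>) =
      transposition_length A (map_permutation X f \<theta>' \<circ> \<gamma>) + (if \<theta> b = b then m else Suc m)"
    if f: "inj_on f (X \<union> insert b C)" and A: "finite A" "A \<inter> f ` (X \<union> insert b C) = f ` X" and \<gamma>: "\<gamma> permutes A"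
    for f :: "'a \<Rightarrow> 'b" and A \<gamma>
  proof -
    define A1 where "A1 = A \<union> f ` C"
    define p where "p = map_permutation (X \<union> C) f \<theta>1 \<circ> \<gamma>"
    have f': "inj_on f (X \<union> C)"
      using f by (rule inj_on_subset) auto
    have fb: "f b \<notin> f ` X" "f b \<notin> f ` C"
      using f b by (auto simp: inj_on_def)
    have A': "A \<inter> f ` (X \<union> C) = f ` X"
      using A(2) fb by blast
    have XA: "f ` X \<subseteq> A"
      using A by blast
    have bA1: "f b \<notin> A1"
      unfolding A1_def using A(2) fb by blast
    have finA1: "finite A1"
      unfolding A1_def using A insert.hyps by simp
    have "map_permutation (X \<union> C) f \<theta>1 permutes A1"
      by (rule permutes_subset[OF map_permutation_permutes_image[OF f' \<theta>1]]) (use XA in \<open>auto simp: A1_def\<close>)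
    moreover have "\<gamma> permutes A1"
      using \<gamma> by (rule permutes_subset) (auto simp: A1_def)
    ultimately have p: "p permutes A1"
      unfolding p_def by (intro permutes_compose)
    have len: "transposition_length A1 p = transposition_length A (map_permutation X f \<theta>' \<circ> \<gamma>) + m"
      unfolding A1_def p_def using m[rule_format, OF f' A(1) A' \<gamma>] .
    have map\<theta>1: "map_permutation (X \<union> insert b C) f \<theta>1 = map_permutation (X \<union> C) f \<theta>1"
      by (rule map_permutation_superset) (use \<theta>1 f in auto)
    have Aeq: "A \<union> f ` insert b C = insert (f b) A1"
      by (auto simp: A1_def)
    have le: "num_cycles A1 p \<le> card A1"
      using finA1 by (rule num_cycles_le_card)
    show ?thesis
    \<comment> \<open>A fixed new point adds one point and one cycle, so the length stays. A moved
      one is absorbed into the cycle of \<open>f (\<theta> b)\<close>: one more point, no more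
      cycles, hence the \<open>Suc\<close>.\<close>
    proof (cases "\<theta> b = b")
      case True
      then have "\<theta>1 = \<theta>"
        by (simp add: \<theta>1_def)
      then have "map_permutation (X \<union> insert b C) f \<theta> = map_permutation (X \<union> C) f \<theta>1"
        using map\<theta>1 by (simp only:)
      then have "transposition_length (A \<union> f ` insert b C) (map_permutation (X \<union> insert b C) f \<theta> \<circ> \<gamma>) =
          transposition_length (insert (f b) A1) p"
        by (simp only: Aeq p_def)
      also have "\<dots> = transposition_length A1 p"
        using num_cycles_insert_fixed[OF p finA1 bA1] bA1 finA1 by (simp add: transposition_length_def)
      finally show ?thesis
        using True len by simp
    next
      case False
      have \<theta>b: "\<theta> b \<in> X \<union> C"
        using permutes_in_image[OF insert.prems(3), of b] False by auto
      have "map_permutation (X \<union> insert b C) f \<theta> =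
          Transposition.transpose (f b) (f (\<theta> b)) \<circ> map_permutation (X \<union> C) f \<theta>1"
      proof -
        have "map_permutation (X \<union> insert b C) f \<theta> =
            map_permutation (X \<union> insert b C) f (Transposition.transpose b (\<theta> b)) \<circ>
            map_permutation (X \<union> insert b C) f \<theta>1"
          using map_permutation_compose'[OF f permutes_subset[OF \<theta>1], of "Transposition.transpose b (\<theta> b)"]
          unfolding \<theta>_eq[symmetric] by blast
        also have "map_permutation (X \<union> insert b C) f (Transposition.transpose b (\<theta> b)) =
            Transposition.transpose (f b) (f (\<theta> b))"
          using f \<theta>b by (intro map_permutation_transpose) auto
        finally show ?thesis
          unfolding map\<theta>1 .
      qed
      then have "transposition_length (A \<union> f ` insert b C) (map_permutation (X \<union> insert b C) f \<theta> \<circ> \<gamma>) =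
          transposition_length (insert (f b) A1) (Transposition.transpose (f b) (f (\<theta> b)) \<circ> p)"
        by (simp only: Aeq p_def comp_assoc)
      also have "\<dots> = Suc (transposition_length A1 p)"
      proof -
        have "f (\<theta> b) \<in> A1"
          using \<theta>b XA by (auto simp: A1_def)
        then show ?thesis
          using num_cycles_absorb_fixed[OF p finA1 _ bA1] bA1 finA1 le
          by (simp add: transposition_length_def Suc_diff_le)
      qed
      finally show ?thesis
        using False len by simp
    qed
  qed
  \<comment> \<open>Both witnesses depend on \<theta> alone and precede \<open>f\<close>,
    \<open>A\<close> and \<gamma>. This uniformity is what later makes the transfer matrix
    independent of \<open>n\<close>.\<close>
  show ?case
    by (rule exI[of _ \<theta>'], rule exI[of _ "if \<theta> b = b then m else Suc m"],
        intro conjI allI impI \<theta>' step; assumption)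
qed

section \<open>Permutations with prescribed cycles\<close>

text \<open>Rotation systems stripped of the graph: only the fibres of \<open>h\<close> matter, one
  cycle on each. Vertex names can thus be exchanged freely, and parts of a graph can be treated
  separately.\<close>

definition rotations :: "'d set \<Rightarrow> ('d \<Rightarrow> 'v) \<Rightarrow> ('d \<Rightarrow> 'd) set" where
  "rotations D h = {\<rho>. \<rho> permutes D \<and> (\<forall>d\<in>D. cyclic_on \<rho> {x \<in> D. h x = h d})}"

lemma rotations_permutes: "\<rho> \<in> rotations D h \<Longrightarrow> \<rho> permutes D"
  by (simp add: rotations_def)

lemma finite_rotations: "finite D \<Longrightarrow> finite (rotations D h)"
  by (rule finite_subset[OF _ finite_permutations[of D]]) (auto simp: rotations_def)

lemma rotations_cong:
  assumes "\<And>x y. x \<in> D \<Longrightarrow> y \<in> D \<Longrightarrow> h x = h y \<longleftrightarrow> h' x = h' y"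
  shows "rotations D h = rotations D h'"
proof -
  have "{x \<in> D. h x = h d} = {x \<in> D. h' x = h' d}" if "d \<in> D" for d
    using assms that by blast
  then show ?thesis
    by (simp add: rotations_def)
qed

lemma num_cycles_rotation:
  assumes "\<rho> \<in> rotations D h"
  shows "num_cycles D \<rho> = card (h ` D)"
proof -
  have "orbit \<rho> d = {x \<in> D. h x = h d}" if "d \<in> D" for d
    using assms that by (intro orbit_cyclic_eq3) (auto simp: rotations_def)
  then have "orbit \<rho> ` D = (\<lambda>v. {x \<in> D. h x = v}) ` h ` D"
    by (simp add: image_image)
  moreover have "inj_on (\<lambda>v. {x \<in> D. h x = v}) (h ` D)"
    by (rule inj_onI) blast
  ultimately show ?thesis
    by (simp add: num_cycles_def card_image)
qed

text \<open>No fibre of \<open>h\<close> meets both parts, so each rotation preserves both and is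
  the product of its two restrictions; \<open>perm_restrict\<close> supplies the inverse
  map.\<close>

lemma rotations_union:
  assumes "finite (D1 \<union> D2)" "D1 \<inter> D2 = {}" "h ` D1 \<inter> h ` D2 = {}"
  shows "bij_betw (\<lambda>(\<rho>, \<tau>). \<tau> \<circ> \<rho>) (rotations D1 h \<times> rotations D2 h) (rotations (D1 \<union> D2) h)"
proof -
  have fibre1: "{x \<in> D1 \<union> D2. h x = h d} = {x \<in> D1. h x = h d}" if "d \<in> D1" for d
    using assms(3) that by blast
  have fibre2: "{x \<in> D1 \<union> D2. h x = h d} = {x \<in> D2. h x = h d}" if "d \<in> D2" for d
    using assms(3) that by blast
  have on1: "(\<tau> \<circ> \<rho>) x = \<rho> x" if "\<rho> permutes D1" "\<tau> permutes D2" "x \<in> D1" for \<rho> \<tau> x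
    using that assms(2) permutes_in_image[of \<rho> D1 x] by (auto intro: permutes_not_in)
  have on2: "(\<tau> \<circ> \<rho>) x = \<tau> x" if "\<rho> permutes D1" "\<tau> permutes D2" "x \<in> D2" for \<rho> \<tau> x
    using that assms(2) permutes_not_in[of \<rho> D1 x] by (metis comp_apply disjoint_iff)
  have split: "perm_restrict \<sigma> D \<in> rotations D h"
    if \<sigma>: "\<sigma> \<in> rotations (D1 \<union> D2) h" and D: "D \<subseteq> D1 \<union> D2"
      and fib: "\<And>d. d \<in> D \<Longrightarrow> {x \<in> D1 \<union> D2. h x = h d} = {x \<in> D. h x = h d}" for \<sigma> D
  proof -
    have cyc: "cyclic_on \<sigma> {x \<in> D. h x = h d}" if "d \<in> D" for d
    proof -
      have "cyclic_on \<sigma> {x \<in> D1 \<union> D2. h x = h d}"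
        using \<sigma> D that by (auto simp: rotations_def)
      then show ?thesis
        by (simp only: fib[OF that])
    qed
    have "\<sigma> d \<in> D" if "d \<in> D" for d
      using cyclic_on_inI[OF cyc[OF that], of d] that by simp
    moreover have "inj_on \<sigma> D"
      using permutes_inj[OF rotations_permutes[OF \<sigma>]] inj_on_subset by blast
    moreover have "finite D"
      using D assms(1) finite_subset by blast
    ultimately have "bij_betw \<sigma> D D"
      by (simp add: bij_betw_def endo_inj_surj image_subsetI)
    then have "bij_betw (perm_restrict \<sigma> D) D D"
      by (subst bij_betw_cong[where g = \<sigma>]) (simp_all add: perm_restrict_simps)
    then have "perm_restrict \<sigma> D permutes D"
      by (rule bij_imp_permutes) (simp add: perm_restrict_simps)
    moreover have "cyclic_on (perm_restrict \<sigma> D) {x \<in> D. h x = h d}" if "d \<in> D" for d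
      using cyc[OF that] by (subst cyclic_cong[where g = \<sigma>]) (simp_all add: perm_restrict_simps)
    ultimately show ?thesis
      by (simp add: rotations_def)
  qed
  have comp: "\<tau> \<circ> \<rho> \<in> rotations (D1 \<union> D2) h"
    if \<rho>: "\<rho> \<in> rotations D1 h" and \<tau>: "\<tau> \<in> rotations D2 h" for \<rho> \<tau>
  proof -
    have perm: "\<rho> permutes D1" "\<tau> permutes D2"
      using \<rho> \<tau> by (auto intro: rotations_permutes)
    have "\<tau> \<circ> \<rho> permutes D1 \<union> D2"
      using permutes_compose[OF permutes_subset[OF perm(1)] permutes_subset[OF perm(2)]] by blast
    moreover have "cyclic_on (\<tau> \<circ> \<rho>) {x \<in> D1. h x = h d}" if "d \<in> D1" for d
      using \<rho> that by (subst cyclic_cong[where g = \<rho>]) (auto simp: rotations_def on1[OF perm, unfolded comp_def])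
    moreover have "cyclic_on (\<tau> \<circ> \<rho>) {x \<in> D2. h x = h d}" if "d \<in> D2" for d
      using \<tau> that by (subst cyclic_cong[where g = \<tau>]) (auto simp: rotations_def on2[OF perm, unfolded comp_def])
    ultimately show ?thesis
      using fibre1 fibre2 unfolding rotations_def mem_Collect_eq by (metis (no_types, lifting) UnE)
  qed
  show ?thesis
  proof (rule bij_betw_byWitness[where f' = "\<lambda>\<sigma>. (perm_restrict \<sigma> D1, perm_restrict \<sigma> D2)"])
    show "\<forall>a\<in>rotations D1 h \<times> rotations D2 h.
        (\<lambda>\<sigma>. (perm_restrict \<sigma> D1, perm_restrict \<sigma> D2)) ((\<lambda>(\<rho>, \<tau>). \<tau> \<circ> \<rho>) a) = a"
    proof
      fix a assume "a \<in> rotations D1 h \<times> rotations D2 h"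
      then obtain \<rho> \<tau> where a: "a = (\<rho>, \<tau>)" "\<rho> \<in> rotations D1 h" "\<tau> \<in> rotations D2 h"
        by blast
      then have "\<rho> permutes D1" "\<tau> permutes D2"
        by (auto intro: rotations_permutes)
      then have "perm_restrict (\<tau> \<circ> \<rho>) D1 = \<rho>" "perm_restrict (\<tau> \<circ> \<rho>) D2 = \<tau>"
        using on1 on2 by (auto simp: fun_eq_iff perm_restrict_def permutes_not_in)
      then show "(\<lambda>\<sigma>. (perm_restrict \<sigma> D1, perm_restrict \<sigma> D2)) ((\<lambda>(\<rho>, \<tau>). \<tau> \<circ> \<rho>) a) = a"
        by (simp add: a)
    qed
    show "\<forall>\<sigma>\<in>rotations (D1 \<union> D2) h. (\<lambda>(\<rho>, \<tau>). \<tau> \<circ> \<rho>) (perm_restrict \<sigma> D1, perm_restrict \<sigma> D2) = \<sigma>"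
    proof
      fix \<sigma> assume \<sigma>: "\<sigma> \<in> rotations (D1 \<union> D2) h"
      have "perm_restrict \<sigma> D2 \<circ> perm_restrict \<sigma> D1 = perm_restrict \<sigma> (D2 \<union> D1)"
        by (intro perm_restrict_union rotations_permutes[of _ _ h] split[OF \<sigma>] fibre1 fibre2)
          (use assms in auto)
      also have "\<dots> = \<sigma>"
        using rotations_permutes[OF \<sigma>] by (simp add: Un_commute)
      finally show "(\<lambda>(\<rho>, \<tau>). \<tau> \<circ> \<rho>) (perm_restrict \<sigma> D1, perm_restrict \<sigma> D2) = \<sigma>"
        by simp
    qed
    show "(\<lambda>(\<rho>, \<tau>). \<tau> \<circ> \<rho>) ` (rotations D1 h \<times> rotations D2 h) \<subseteq> rotations (D1 \<union> D2) h"
      using comp by auto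
    show "(\<lambda>\<sigma>. (perm_restrict \<sigma> D1, perm_restrict \<sigma> D2)) ` rotations (D1 \<union> D2) h
        \<subseteq> rotations D1 h \<times> rotations D2 h"
      using split fibre1 fibre2 by auto
  qed
qed

lemma sum_rotations_union:
  assumes "finite (D1 \<union> D2)" "D1 \<inter> D2 = {}" "h ` D1 \<inter> h ` D2 = {}"
  shows "(\<Sum>\<sigma>\<in>rotations (D1 \<union> D2) h. g \<sigma>) = (\<Sum>\<rho>\<in>rotations D1 h. \<Sum>\<tau>\<in>rotations D2 h. g (\<tau> \<circ> \<rho>))"
  unfolding sum.reindex_bij_betw[OF rotations_union[OF assms], symmetric] sum.cartesian_product
  by (simp add: case_prod_unfold)

lemma map_permutation_rotations:
  assumes "inj_on f D" and h: "\<And>x y. x \<in> D \<Longrightarrow> y \<in> D \<Longrightarrow> h' (f x) = h' (f y) \<longleftrightarrow> h x = h y"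
    and "\<rho> \<in> rotations D h"
  shows "map_permutation D f \<rho> \<in> rotations (f ` D) h'"
proof -
  have "cyclic_on (map_permutation D f \<rho>) {y \<in> f ` D. h' y = h' (f d)}" if "d \<in> D" for d
  proof -
    have "{y \<in> f ` D. h' y = h' (f d)} = f ` {x \<in> D. h x = h d}"
      using h that by auto
    then show ?thesis
      using assms that by (auto intro!: cyclic_on_image[where f = \<rho>] simp: rotations_def map_permutation_apply)
  qed
  then show ?thesis
    using assms map_permutation_permutes_image by (auto simp: rotations_def)
qed

text \<open>The hypothesis on \<open>h\<close> and \<open>h'\<close> says that \<open>f\<close>
  matches fibres with fibres; transport along \<open>f\<close> and along \<open>inv_into D f\<close>
  are then mutually inverse.\<close>

lemma sum_rotations_image:
  assumes inj: "inj_on f D" and h: "\<And>x y. x \<in> D \<Longrightarrow> y \<in> D \<Longrightarrow> h' (f x) = h' (f y) \<longleftrightarrow> h x = h y"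
  shows "(\<Sum>\<tau>\<in>rotations (f ` D) h'. g \<tau>) = (\<Sum>\<rho>\<in>rotations D h. g (map_permutation D f \<rho>))"
proof -
  have bij: "bij_betw f D (f ` D)" "bij_betw (inv_into D f) (f ` D) D"
    using inj by (auto simp: bij_betw_def inj_on_inv_into)
  have h_inv: "h (inv_into D f x) = h (inv_into D f y) \<longleftrightarrow> h' x = h' y" if "x \<in> f ` D" "y \<in> f ` D" for x y
    using h[of "inv_into D f x" "inv_into D f y"] that by (simp add: f_inv_into_f inv_into_into)
  have inv: "map_permutation (f ` D) (inv_into D f) \<tau> \<in> rotations D h" if "\<tau> \<in> rotations (f ` D) h'" for \<tau>
    using map_permutation_rotations[where h = h' and h' = h, OF _ h_inv that] bij(2) by (simp add: bij_betw_def)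
  have right: "map_permutation D f (map_permutation (f ` D) (inv_into D f) \<tau>) = \<tau>"
    if "\<tau> \<in> rotations (f ` D) h'" for \<tau>
    using map_permutation_compose_inv[OF bij(2) rotations_permutes[OF that] f_inv_into_f] .
  have left: "map_permutation (f ` D) (inv_into D f) (map_permutation D f \<rho>) = \<rho>"
    if "\<rho> \<in> rotations D h" for \<rho>
    using map_permutation_compose_inv[OF bij(1) rotations_permutes[OF that] inv_into_f_f[OF inj]] .
  show ?thesis
    by (rule sum.reindex_bij_witness[where i = "map_permutation D f" and j = "map_permutation (f ` D) (inv_into D f)"])
      (simp_all add: left right inv map_permutation_rotations[where h = h and h' = h', OF inj h])
qed

section \<open>The genus polynomial in terms of lengths of face permutations\<close>

lemma rotation_system_iff:
  assumes "\<And>d. d \<in> edge_ends G \<Longrightarrow> end_vertex G d \<in> verts G"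
  shows "rotation_system G \<rho> \<longleftrightarrow> \<rho> \<in> rotations (edge_ends G) (end_vertex G)"
proof -
  have "(\<forall>v \<in> verts G. ends_at G v \<noteq> {} \<longrightarrow> cyclic_on \<rho> (ends_at G v)) \<longleftrightarrow>
      (\<forall>d \<in> edge_ends G. cyclic_on \<rho> (ends_at G (end_vertex G d)))"
    using assms by (fastforce simp: ends_at_def)
  then show ?thesis
    by (simp add: rotation_system_def rotations_def ends_at_def)
qed

lemma pcompose_monom_square: "pcompose (monom 1 i) [:0, 0, 1:] = (monom 1 (2 * i) :: int poly)"
proof -
  have "[:0, 0, 1:] = (monom 1 2 :: int poly)"
    by (simp add: monom_Suc numeral_2_eq_2 monom_0)
  then have "pcompose (monom 1 i) [:0, 0, 1:] = (monom 1 2 :: int poly) ^ i"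
    by (induction i) (simp_all add: monom_0 monom_Suc pcompose_pCons)
  then show ?thesis
    by (simp add: monom_power)
qed

text \<open>The length of the face permutation is \<open>2|E| - F\<close>, so Euler's formula
  \<open>|V| - |E| + F = 2 - 2g\<close> becomes \<open>2 + length = |V| + |E| + 2g\<close>; keeping
  the 2 on the left avoids negative exponents. The hypothesis \<open>img\<close> excludes isolated
  vertices, and \<open>conn\<close> is connectedness expressed on edge-ends.\<close>

lemma genus_poly_transposition_length:
  fixes G :: "('v, 'e) pre_digraph"
  defines "\<alpha> \<equiv> \<lambda>d. if fst d \<in> arcs G then other_end d else d"
  assumes fin: "finite (arcs G)" and ne: "arcs G \<noteq> {}"
    and img: "end_vertex G ` edge_ends G = verts G"
    and conn: "\<And>T. T \<subseteq> edge_ends G \<Longrightarrow> T \<noteq> {} \<Longrightarrow>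
        (\<And>d d'. d \<in> T \<Longrightarrow> d' \<in> edge_ends G \<Longrightarrow> end_vertex G d = end_vertex G d' \<Longrightarrow> d' \<in> T) \<Longrightarrow>
        (\<And>d. d \<in> T \<Longrightarrow> other_end d \<in> T) \<Longrightarrow> T = edge_ends G"
  shows "monom 1 2 * (\<Sum>\<rho>\<in>rotations (edge_ends G) (end_vertex G).
        monom 1 (transposition_length (edge_ends G) (\<rho> \<circ> \<alpha>))) =
      monom 1 (card (verts G) + card (arcs G)) * pcompose (genus_poly G) [:0, 0, 1:]"
proof -
  let ?D = "edge_ends G" and ?V = "card (verts G)" and ?E = "card (arcs G)"
  let ?R = "rotations ?D (end_vertex G)"
  have D: "?D = arcs G \<times> UNIV"
    by (simp add: edge_ends_def)
  have finD: "finite ?D" and cardD: "card ?D = 2 * ?E"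
    using fin by (simp_all add: D card_cartesian_product)
  have finR: "finite ?R"
    using finD by (rule finite_rotations)
  have rs: "rotation_system G \<rho> \<longleftrightarrow> \<rho> \<in> ?R" for \<rho>
    using img by (intro rotation_system_iff) blast
  have \<alpha>: "\<alpha> permutes ?D"
  proof (rule bij_imp_permutes)
    show "bij_betw \<alpha> ?D ?D"
      by (rule bij_betw_byWitness[where f' = \<alpha>]) (auto simp: \<alpha>_def D other_end_def)
  qed (auto simp: \<alpha>_def D)
  have faces: "num_faces G \<rho> = num_cycles ?D (\<rho> \<circ> \<alpha>)" if "\<rho> \<in> ?R" for \<rho>
  proof -
    \<comment> \<open>Outside \<open>?D\<close>, \<open>other_end\<close> still moves points, so it
      is no permutation of \<open>?D\<close> in the sense of \<open>permutes\<close>; \<alpha> is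
      its truncation, with the same orbits inside \<open>?D\<close>.\<close>
    have "num_cycles ?D (\<rho> \<circ> \<alpha>) = num_cycles ?D (\<rho> \<circ> other_end)"
      using permutes_image[OF permutes_compose[OF \<alpha> rotations_permutes[OF that]]]
      by (intro num_cycles_cong) (auto simp: \<alpha>_def D)
    moreover have "{v \<in> verts G. ends_at G v = {}} = {}"
      unfolding img[symmetric] by (auto simp: ends_at_def)
    ultimately show ?thesis
      by (simp only: num_faces_def num_cycles_def card.empty add_0_right)
  qed
  have "\<exists>g. int ?V - int ?E + int (num_faces G \<rho>) = 2 - 2 * int g" if \<rho>: "\<rho> \<in> ?R" for \<rho>
  proof -
    have "\<exists>g. int (num_cycles (arcs G \<times> UNIV) \<rho>) - int ?E + int (num_cycles (arcs G \<times> UNIV)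
        (\<rho> \<circ> (\<lambda>d. if fst d \<in> arcs G then other_end d else d))) = 2 - 2 * int g"
    proof (rule euler_genus)
      fix T assume T: "T \<subseteq> arcs G \<times> (UNIV :: bool set)" "T \<noteq> {}" "\<rho> ` T \<subseteq> T"
        "\<And>e s. e \<in> arcs G \<Longrightarrow> (e, s) \<in> T \<Longrightarrow> (e, \<not> s) \<in> T"
      show "T = arcs G \<times> UNIV"
        unfolding D[symmetric]
      proof (rule conn)
        fix d d' assume d: "d \<in> T" "d' \<in> ?D" "end_vertex G d = end_vertex G d'"
        have dD: "d \<in> ?D"
          using d T D by blast
        have "cyclic_on \<rho> {x \<in> ?D. end_vertex G x = end_vertex G d}"
          using \<rho> dD by (simp add: rotations_def)
        then have "orbit \<rho> d = {x \<in> ?D. end_vertex G x = end_vertex G d}"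
          using dD by (intro orbit_cyclic_eq3) auto
        with d have "d' \<in> orbit \<rho> d" by simp
        then show "d' \<in> T"
          by induction (use d T(3) in auto)
      next
        fix d assume "d \<in> T"
        then show "other_end d \<in> T"
          using T(1) T(4)[of "fst d" "snd d"] by (auto simp: other_end_def)
      qed (use T D in auto)
    qed (use fin ne rotations_permutes[OF \<rho>] in \<open>auto simp: D\<close>)
    then show ?thesis
      using faces[OF \<rho>] num_cycles_rotation[OF \<rho>] by (simp add: img D[symmetric] \<alpha>_def)
  qed
  then obtain g where g: "\<And>\<rho>. \<rho> \<in> ?R \<Longrightarrow> int ?V - int ?E + int (num_faces G \<rho>) = 2 - 2 * int (g \<rho>)"
    by metis
  have "genus_poly G = (\<Sum>\<rho>\<in>?R. monom 1 (g \<rho>))"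
  proof (rule poly_eqI)
    fix i
    have "{\<rho>. rotation_system G \<rho> \<and> int ?V - int ?E + int (num_faces G \<rho>) = 2 - 2 * int i} = {\<rho> \<in> ?R. g \<rho> = i}"
      using g by (auto simp: rs)
    then show "coeff (genus_poly G) i = coeff (\<Sum>\<rho>\<in>?R. monom 1 (g \<rho>)) i"
      using finR by (simp add: coeff_genus_poly[OF fin] genus_count_def coeff_sum sum.If_cases Int_def)
  qed
  then have "pcompose (genus_poly G) [:0, 0, 1:] = (\<Sum>\<rho>\<in>?R. monom 1 (2 * g \<rho>))"
    by (simp add: pcompose_sum pcompose_monom_square)
  moreover have "2 + transposition_length ?D (\<rho> \<circ> \<alpha>) = ?V + ?E + 2 * g \<rho>" if "\<rho> \<in> ?R" for \<rho>
    using g[OF that] faces[OF that] cardD num_cycles_le_card[OF finD, of "\<rho> \<circ> \<alpha>"]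
    by (simp add: transposition_length_def)
  ultimately show ?thesis
    unfolding sum_distrib_left by (auto simp: mult_monom sum_distrib_left intro!: sum.cong)
qed

section \<open>Recurrences and rational generating functions\<close>

text \<open>Fraction-free Gaussian elimination: a coordinate at which all vectors vanish is dropped;
  otherwise a pivot vector eliminates it, at the cost of one vector.\<close>

lemma linear_dependence:
  fixes r :: "'k \<Rightarrow> 's \<Rightarrow> 'a :: idom"
  assumes "finite S" "finite K" "card S < card K"
  shows "\<exists>c. (\<exists>k\<in>K. c k \<noteq> 0) \<and> (\<forall>s\<in>S. (\<Sum>k\<in>K. c k * r k s) = 0)"
  using assms
proof (induction S arbitrary: K r)
  case empty
  then have "K \<noteq> {}" by auto
  then show ?case
    by (intro exI[of _ "\<lambda>_. 1"]) auto
next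
  case (insert s S)
  show ?case
  proof (cases "\<forall>k\<in>K. r k s = 0")
    case True
    with insert.IH[of K r] insert.prems insert.hyps show ?thesis
      by auto
  next
    case False
    then obtain j where j: "j \<in> K" "r j s \<noteq> 0" by blast
    define r' where "r' k t = r j s * r k t - r k s * r j t" for k t
    have "card S < card (K - {j})"
      using insert.prems insert.hyps j by simp
    with insert.IH[of "K - {j}" r'] insert.prems obtain c where
      c: "\<exists>k\<in>K - {j}. c k \<noteq> 0" "\<And>t. t \<in> S \<Longrightarrow> (\<Sum>k\<in>K - {j}. c k * r' k t) = 0"
      by blast
    \<comment> \<open>Scaling by the pivot \<open>r j s\<close> undoes the cross-multiplication in
      \<open>r'\<close>, and keeps a non-zero coefficient non-zero because the ring is a domain. The
      coefficient at \<open>j\<close> collects the multiples of the pivot vector that were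
      subtracted.\<close>
    define c' where "c' k = (if k = j then - (\<Sum>k\<in>K - {j}. c k * r k s) else c k * r j s)" for k
    have "(\<Sum>k\<in>K. c' k * r k t) = (\<Sum>k\<in>K - {j}. c k * r' k t)" for t
    proof -
      have "(\<Sum>k\<in>K. c' k * r k t) = c' j * r j t + (\<Sum>k\<in>K - {j}. c' k * r k t)"
        using insert.prems j by (simp add: sum.remove)
      also have "(\<Sum>k\<in>K - {j}. c' k * r k t) = (\<Sum>k\<in>K - {j}. c k * r j s * r k t)"
        by (intro sum.cong) (auto simp: c'_def)
      also have "c' j * r j t = - (\<Sum>k\<in>K - {j}. c k * r k s * r j t)"
        by (simp add: c'_def sum_distrib_right)
      finally show ?thesis
        by (simp add: r'_def algebra_simps sum_subtractf)
    qed
    moreover have "(\<Sum>k\<in>K - {j}. c k * r' k s) = 0"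
      by (simp add: r'_def)
    moreover have "\<exists>k\<in>K. c' k \<noteq> 0"
      using c(1) j by (auto simp: c'_def)
    ultimately show ?thesis
      using c(2) by (intro exI[of _ c']) auto
  qed
qed

text \<open>Instead of powers of the matrix, only the row vectors \<open>w M^k\<close> are compared.
  There are \<open>card S + 1\<close> of them for \<open>k \<le> card S\<close> in
  \<open>card S\<close> coordinates, and a dependence among them does not involve
  \<open>n\<close>.\<close>

lemma transfer_recurrence:
  fixes a :: "'s \<Rightarrow> nat \<Rightarrow> 'a :: idom"
  assumes "finite S"
    and step: "\<And>s n. s \<in> S \<Longrightarrow> n \<ge> 1 \<Longrightarrow> a s (Suc n) = (\<Sum>s'\<in>S. M s s' * a s' n)"
  shows "\<exists>d c. (\<exists>k\<le>d. c k \<noteq> 0) \<and>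
    (\<forall>n\<ge>1. (\<Sum>k\<le>d. c k * (\<Sum>s\<in>S. w s * a s (n + k))) = 0)"
proof -
  define W where "W = rec_nat w (\<lambda>_ v s'. \<Sum>s\<in>S. v s * M s s')"
  have W_Suc: "W (Suc k) s' = (\<Sum>s\<in>S. W k s * M s s')" and W_0: "W 0 = w" for k s'
    by (simp_all add: W_def)
  have shift: "(\<Sum>s\<in>S. v s * a s (Suc n)) = (\<Sum>s'\<in>S. (\<Sum>s\<in>S. v s * M s s') * a s' n)" if "n \<ge> 1" for v n
  proof -
    have "(\<Sum>s\<in>S. v s * a s (Suc n)) = (\<Sum>s\<in>S. \<Sum>s'\<in>S. v s * M s s' * a s' n)"
      using that by (intro sum.cong) (simp_all add: step sum_distrib_left mult.assoc)
    also have "\<dots> = (\<Sum>s'\<in>S. \<Sum>s\<in>S. v s * M s s' * a s' n)"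
      by (rule sum.swap)
    finally show ?thesis
      by (simp add: sum_distrib_right)
  qed
  have W: "(\<Sum>s\<in>S. w s * a s (n + k)) = (\<Sum>s\<in>S. W k s * a s n)" if "n \<ge> 1" for n k
    using that
  proof (induction k arbitrary: n)
    case 0
    then show ?case by (simp add: W_0)
  next
    case (Suc k)
    from Suc.IH[of "Suc n"] show ?case
      using shift[OF Suc.prems] by (simp add: W_Suc)
  qed
  obtain c where c: "\<exists>k\<in>{..card S}. c k \<noteq> 0" "\<And>s. s \<in> S \<Longrightarrow> (\<Sum>k\<le>card S. c k * W k s) = 0"
    using linear_dependence[OF assms(1), of "{..card S}" W] by auto
  have "(\<Sum>k\<le>card S. c k * (\<Sum>s\<in>S. w s * a s (n + k))) = 0" if "n \<ge> 1" for n
  proof -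
    have "(\<Sum>k\<le>card S. c k * (\<Sum>s\<in>S. w s * a s (n + k))) =
        (\<Sum>k\<le>card S. \<Sum>s\<in>S. c k * W k s * a s n)"
      by (simp add: W[OF that] sum_distrib_left mult.assoc)
    also have "\<dots> = (\<Sum>s\<in>S. \<Sum>k\<le>card S. c k * W k s * a s n)"
      by (rule sum.swap)
    also have "\<dots> = (\<Sum>s\<in>S. (\<Sum>k\<le>card S. c k * W k s) * a s n)"
      by (simp add: sum_distrib_right)
    finally show ?thesis
      by (simp add: c(2))
  qed
  with c(1) show ?thesis by blast
qed

text \<open>Writing a polynomial in \<open>y\<close> as \<open>e(y^2) + y o(y^2)\<close>, this is
  \<open>e\<close>. It is the projection that is linear over polynomials in
  \<open>x = y^2\<close>.\<close>

definition even_part :: "'a :: comm_semiring_1 poly \<Rightarrow> 'a poly" where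
  "even_part p = Abs_poly (\<lambda>i. coeff p (2 * i))"

lemma coeff_even_part: "coeff (even_part p) i = coeff p (2 * i)"
proof -
  have "\<forall>\<^sub>\<infinity> i. coeff p (2 * i) = 0"
    unfolding MOST_nat by (rule exI[of _ "degree p"]) (auto intro: coeff_eq_0)
  then show ?thesis
    unfolding even_part_def by (simp add: Abs_poly_inverse)
qed

lemma even_part_add: "even_part (p + q) = even_part p + even_part q"
  by (simp add: poly_eq_iff coeff_even_part)

lemma even_part_0: "even_part 0 = 0"
  by (simp add: poly_eq_iff coeff_even_part)

lemma even_part_sum: "even_part (\<Sum>i\<in>I. f i) = (\<Sum>i\<in>I. even_part (f i))"
  by (induction I rule: infinite_finite_induct) (simp_all add: even_part_add even_part_0)

lemma even_part_smult: "even_part (smult a p) = smult a (even_part p)"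
  by (simp add: poly_eq_iff coeff_even_part)

lemma even_part_shift: "even_part (pCons 0 (pCons 0 p)) = pCons 0 (even_part p)"
  by (simp add: poly_eq_iff coeff_even_part coeff_pCons split: nat.split)

lemma even_part_mult_pcompose_square:
  fixes q :: "'a :: comm_ring_1 poly"
  shows "even_part (q * pcompose p [:0, 0, 1:]) = even_part q * p"
proof (induction p)
  case (pCons a p)
  have "q * pcompose (pCons a p) [:0, 0, 1:] = smult a q + pCons 0 (pCons 0 (q * pcompose p [:0, 0, 1:]))"
    by (simp add: pcompose_pCons algebra_simps)
  then show ?case
    by (simp add: even_part_add even_part_smult even_part_shift pCons.IH)
qed (simp add: even_part_0)

text \<open>Multiplying by the variable moves the odd coefficients to even positions.\<close>

lemma even_part_eq_0_imp:
  fixes q :: "'a :: comm_ring_1 poly"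
  assumes "even_part q = 0" "even_part (pCons 0 q) = 0"
  shows "q = 0"
proof (rule poly_eqI)
  fix i
  show "coeff q i = coeff 0 i"
  proof (cases "even i")
    case True
    then obtain j where "i = 2 * j" by (elim evenE)
    with assms(1) coeff_even_part[of q j] show ?thesis by simp
  next
    case False
    then obtain j where "i = 2 * j + 1" by (elim oddE)
    with assms(2) coeff_even_part[of "pCons 0 q" "Suc j"] show ?thesis by simp
  qed
qed

lemma recurrence_imp_rational_fraction:
  fixes a c :: "nat \<Rightarrow> int poly"
  assumes "\<exists>k\<le>d. c k \<noteq> 0" and rec: "\<And>n. n \<ge> 1 \<Longrightarrow> (\<Sum>k\<le>d. c k * a (n + k)) = 0"
  shows "rational_fraction (Abs_fps (\<lambda>n. if n = 0 then 0 else a n))"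
proof -
  define F where "F = Abs_fps (\<lambda>n. if n = 0 then 0 else a n)"
  \<comment> \<open>The reversed characteristic polynomial: coefficient \<open>m\<close> of the
    product with \<open>F\<close> is the recurrence at \<open>n = m - d\<close>. It vanishes only
    for \<open>m > d\<close>, since the recurrence starts at \<open>n = 1\<close> and the
    coefficient of \<open>F\<close> at 0 is set to 0 by convention.\<close>
  define Q where "Q = (\<Sum>k\<le>d. monom (c k) (d - k))"
  have coeff_Q: "coeff Q i = (if i \<le> d then c (d - i) else 0)" for i
  proof -
    have "coeff Q i = (\<Sum>k\<le>d. if k = d - i \<and> i \<le> d then c k else 0)"
      unfolding Q_def coeff_sum by (intro sum.cong) auto
    then show ?thesis by auto
  qed
  obtain k where "k \<le> d" "c k \<noteq> 0"
    using assms(1) by blast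
  then have "coeff Q (d - k) \<noteq> 0"
    by (simp add: coeff_Q)
  then have "Q \<noteq> 0" by auto
  have "fps_nth (fps_of_poly Q * F) m = 0" if "m > d" for m
  proof -
    have "fps_nth (fps_of_poly Q * F) m = (\<Sum>i=0..m. coeff Q i * fps_nth F (m - i))"
      by (simp add: fps_mult_nth)
    also have "\<dots> = (\<Sum>i\<in>{0..d}. c (d - i) * a (m - i))"
      using that by (intro sum.mono_neutral_cong_right) (auto simp: coeff_Q F_def)
    also have "\<dots> = (\<Sum>k\<le>d. c k * a (m - d + k))"
      by (rule sum.reindex_bij_witness[where i = "\<lambda>k. d - k" and j = "\<lambda>i. d - i"]) (use that in auto)
    finally show ?thesis
      using rec[of "m - d"] that by simp
  qed
  then have "fps_of_poly Q * F = fps_of_poly (Poly (map (fps_nth (fps_of_poly Q * F)) [0..<Suc d]))"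
    by (intro fps_ext) (auto simp: nth_default_def less_Suc_eq_le simp del: upt_Suc)
  with \<open>Q \<noteq> 0\<close> show ?thesis
    unfolding rational_fraction_def F_def by blast
qed

text \<open>A recurrence with coefficients in \<open>\<int>[y]\<close>, where \<open>x = y\<^sup>2\<close>, yields one with coefficients in
  \<open>\<int>[x]\<close>: the even parts of the coefficients, or else their odd parts, do not all vanish.\<close>
lemma rational_fraction_of_transfer:
  fixes a b :: "nat \<Rightarrow> int poly"
  assumes "\<And>n. n \<ge> 1 \<Longrightarrow> monom 1 2 * b n = monom 1 (C + r * n) * pcompose (a n) [:0, 0, 1:]"
    and "\<exists>k\<le>d. c k \<noteq> 0" and rec: "\<And>n. n \<ge> 1 \<Longrightarrow> (\<Sum>k\<le>d. c k * b (n + k)) = 0"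
  shows "rational_fraction (Abs_fps (\<lambda>n. if n = 0 then 0 else a n))"
proof -
  \<comment> \<open>The exponent at \<open>n + k\<close> is \<open>C + r * n\<close> plus
    \<open>r * k\<close>. The second part is absorbed into the coefficient; the first is common to
    all \<open>k\<close> and cancels.\<close>
  define q where "q k = c k * monom 1 (r * k)" for k
  have q: "(\<Sum>k\<le>d. q k * pcompose (a (n + k)) [:0, 0, 1:]) = 0" if "n \<ge> 1" for n
  proof -
    have "monom 1 (C + r * n) * (q k * pcompose (a (n + k)) [:0, 0, 1:]) = monom 1 2 * (c k * b (n + k))" for k
    proof -
      have "monom 1 2 * (c k * b (n + k)) = c k * (monom 1 2 * b (n + k))"
        by (simp add: ac_simps)
      also have "\<dots> = c k * (monom 1 (C + r * n) * monom 1 (r * k) * pcompose (a (n + k)) [:0, 0, 1:])"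
        using assms(1)[of "n + k"] that by (simp add: mult_monom algebra_simps)
      also have "\<dots> = monom 1 (C + r * n) * (q k * pcompose (a (n + k)) [:0, 0, 1:])"
        by (simp only: q_def ac_simps)
      finally show ?thesis
        by (rule sym)
    qed
    then have "monom 1 (C + r * n) * (\<Sum>k\<le>d. q k * pcompose (a (n + k)) [:0, 0, 1:]) =
        monom 1 2 * (\<Sum>k\<le>d. c k * b (n + k))"
      unfolding sum_distrib_left by (intro sum.cong) simp_all
    also have "\<dots> = 0"
      using rec[OF that] by simp
    finally have "monom 1 (C + r * n) * (\<Sum>k\<le>d. q k * pcompose (a (n + k)) [:0, 0, 1:]) = 0" .
    then show ?thesis
      by (simp add: monom_eq_0_iff)
  qed
  \<comment> \<open>The multiplier \<open>p\<close> will be \<open>1\<close> or the variable,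
    selecting the even or the odd parts of the coefficients.\<close>
  have e: "(\<Sum>k\<le>d. even_part (p * q k) * a (n + k)) = 0" if "n \<ge> 1" for n p
  proof -
    have "(\<Sum>k\<le>d. even_part (p * q k) * a (n + k)) = even_part (\<Sum>k\<le>d. p * q k * pcompose (a (n + k)) [:0, 0, 1:])"
      by (simp only: even_part_sum even_part_mult_pcompose_square)
    also have "\<dots> = even_part (p * (\<Sum>k\<le>d. q k * pcompose (a (n + k)) [:0, 0, 1:]))"
      by (simp add: sum_distrib_left mult.assoc)
    finally show ?thesis
      by (simp add: q[OF that] even_part_0)
  qed
  obtain k where k: "k \<le> d" "c k \<noteq> 0"
    using assms(2) by blast
  then have "q k \<noteq> 0"
    by (simp add: q_def monom_eq_0_iff)
  then consider "even_part (1 * q k) \<noteq> 0" | "even_part ([:0, 1:] * q k) \<noteq> 0"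
    using even_part_eq_0_imp[of "q k"] by auto
  then show ?thesis
  proof cases
    case 1
    with k(1) show ?thesis
      by (intro recurrence_imp_rational_fraction[OF _ e[of _ 1]]) auto
  next
    case 2
    with k(1) show ?thesis
      by (intro recurrence_imp_rational_fraction[OF _ e[of _ "[:0, 1:]"]]) blast
  qed
qed

section \<open>Structure of the linear and circular families\<close>

lemma permutes_disjoint_commute:
  assumes "p permutes A" "q permutes B" "A \<inter> B = {}"
  shows "p \<circ> q = q \<circ> p"
proof
  fix x
  consider "x \<in> A" | "x \<in> B" | "x \<notin> A \<union> B" by blast
  then show "(p \<circ> q) x = (q \<circ> p) x"
  proof cases
    case 1
    then have "x \<notin> B" "p x \<notin> B"
      using assms permutes_in_image[OF assms(1), of x] by auto
    then show ?thesis using permutes_not_in[OF assms(2)] by simp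
  next
    case 2
    then have "x \<notin> A" "q x \<notin> A"
      using assms permutes_in_image[OF assms(2), of x] by auto
    then show ?thesis using permutes_not_in[OF assms(1)] by simp
  next
    case 3
    then show ?thesis using permutes_not_in[OF assms(1)] permutes_not_in[OF assms(2)] by simp
  qed
qed

lemma connected_closed_subset:
  assumes "Digraph_Component.connected G" "u \<in> verts G" "v \<in> verts G" "u \<in> S"
    and closed: "\<And>e. e \<in> arcs G \<Longrightarrow> tail G e \<in> S \<longleftrightarrow> head G e \<in> S"
  shows "v \<in> S"
proof -
  have "\<forall>u\<in>verts G. \<forall>v\<in>verts G. u \<rightarrow>\<^sup>*\<^bsub>mk_symmetric G\<^esub> v"
    using assms(1) unfolding Digraph_Component.connected_def strongly_connected_def by simp
  then have "(u, v) \<in> rtrancl_on (verts G) (parcs (mk_symmetric G))"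
    using assms(2,3) unfolding reachable_def by simp
  then show ?thesis
    using assms(4)
  proof (induction rule: rtrancl_on_induct)
    case (step x y)
    then obtain e where "e \<in> arcs G" "x = tail G e \<and> y = head G e \<or> x = head G e \<and> y = tail G e"
      by (auto simp: parcs_mk_symmetric)
    with step closed[of e] show ?case
      by auto
  qed
qed

lemma other_end_in_edge_ends: "d \<in> edge_ends G \<Longrightarrow> other_end d \<in> edge_ends G"
  by (auto simp: edge_ends_def other_end_def)

lemma merged_level:
  assumes "inj_on \<phi> U"
  shows "merged (Pair l ` U) (\<lambda>v. (m, \<phi> (snd v))) (k, v) =
    (if k = m \<and> v \<in> \<phi> ` U then (l, inv_into U \<phi> v) else (k, v))"
proof (cases "k = m \<and> v \<in> \<phi> ` U")
  case True
  then obtain u where u: "u \<in> U" "v = \<phi> u" by blast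
  have "inj_on (\<lambda>v. (m, \<phi> (snd v))) (Pair l ` U)"
    using assms by (auto simp: inj_on_def)
  then have "inv_into (Pair l ` U) (\<lambda>v. (m, \<phi> (snd v))) (m, \<phi> u) = (l, u)"
    using u by (intro inv_into_f_eq) auto
  then show ?thesis
    using True u assms by (auto simp: merged_def image_iff)
next
  case False
  then show ?thesis
    by (auto simp: merged_def)
qed

locale glued_graph = fin_digraph H for H :: "('v, 'e) pre_digraph" +
  fixes U :: "'v set" and \<phi> :: "'v \<Rightarrow> 'v"
  assumes connected: "Digraph_Component.connected H"
    and U_verts: "U \<subseteq> verts H" and U_nonempty: "U \<noteq> {}"
    and image_verts: "\<phi> ` U \<subseteq> verts H" and disjoint: "U \<inter> \<phi> ` U = {}"
    and inj: "inj_on \<phi> U"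
begin

lemma inv_in_U: "v \<in> \<phi> ` U \<Longrightarrow> inv_into U \<phi> v \<in> U"
  by (rule inv_into_into)

lemma inv_not_in_image: "v \<in> \<phi> ` U \<Longrightarrow> inv_into U \<phi> v \<notin> \<phi> ` U"
  using inv_in_U disjoint by blast

lemma U_not_in_image: "u \<in> U \<Longrightarrow> u \<notin> \<phi> ` U"
  using disjoint by blast

lemma finite_edge_ends: "finite (edge_ends H)"
  by (simp add: edge_ends_def)

lemma end_vertex_in_verts: "d \<in> edge_ends H \<Longrightarrow> end_vertex H d \<in> verts H"
  by (auto simp: edge_ends_def end_vertex_def)

text \<open>A vertex without ends would be the only vertex of the connected graph, but
  \<open>u\<close> and \<open>\<phi> u\<close> are distinct for any
  \<open>u \<in> U\<close>.\<close>

lemma ex_edge_end: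
  assumes "v \<in> verts H"
  shows "\<exists>d \<in> edge_ends H. end_vertex H d = v"
proof (rule ccontr)
  assume none: "\<not> ?thesis"
  have no: "tail H e \<noteq> v" "head H e \<noteq> v" if "e \<in> arcs H" for e
  proof -
    have "(e, s) \<in> edge_ends H" for s
      using that by (simp add: edge_ends_def)
    then have "end_vertex H (e, s) \<noteq> v" for s
      using none by blast
    from this[of False] this[of True] show "tail H e \<noteq> v" "head H e \<noteq> v"
      by (simp_all add: end_vertex_def)
  qed
  obtain u where u: "u \<in> U"
    using U_nonempty by blast
  have "w = v" if "w \<in> verts H" for w
    using connected_closed_subset[OF connected assms that, of "{v}"] no by auto
  then have "u = \<phi> u"
    using u U_verts image_verts by blast
  then show False
    using u disjoint by auto
qed

lemma edge_ends_connected: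
  assumes "T \<subseteq> edge_ends H" "d0 \<in> T"
    and vertex: "\<And>d d'. d \<in> T \<Longrightarrow> d' \<in> edge_ends H \<Longrightarrow> end_vertex H d = end_vertex H d' \<Longrightarrow> d' \<in> T"
    and edge: "\<And>d. d \<in> T \<Longrightarrow> other_end d \<in> T"
  shows "T = edge_ends H"
proof -
  have closed: "tail H e \<in> end_vertex H ` T \<longleftrightarrow> head H e \<in> end_vertex H ` T" if e: "e \<in> arcs H" for e
  proof -
    have *: "end_vertex H (e, \<not> s) \<in> end_vertex H ` T" if "end_vertex H (e, s) \<in> end_vertex H ` T" for s
    proof -
      from that obtain d where d: "d \<in> T" "end_vertex H d = end_vertex H (e, s)"
        by auto
      then have "(e, s) \<in> T"
        using e by (intro vertex[OF d(1)]) (simp_all add: edge_ends_def)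
      then have "(e, \<not> s) \<in> T"
        using edge[of "(e, s)"] by (simp add: other_end_def)
      then show ?thesis by blast
    qed
    show ?thesis
      using *[of True] *[of False] by (auto simp: end_vertex_def)
  qed
  have "d \<in> T" if d: "d \<in> edge_ends H" for d
  proof -
    have "end_vertex H d \<in> end_vertex H ` T"
      using connected_closed_subset[OF connected _ _ _ closed, of "end_vertex H d0" "end_vertex H d"]
        assms(1,2) d end_vertex_in_verts by blast
    then obtain d' where "d' \<in> T" "end_vertex H d = end_vertex H d'"
      by blast
    then show ?thesis
      using vertex[of d' d] d by simp
  qed
  with assms(1) show ?thesis by blast
qed

text \<open>The accumulated effect of all gluings: \<open>\<phi> u\<close> in copy
  \<open>k \<ge> 2\<close> carries the name of \<open>u\<close> in copy \<open>k - 1\<close>. One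
  step suffices, because \<open>U\<close> is disjoint from its image and no vertex is renamed
  twice.\<close>

definition vertex_name :: "nat \<times> 'v \<Rightarrow> nat \<times> 'v" where
  "vertex_name w = (if fst w \<ge> 2 \<and> snd w \<in> \<phi> ` U then (fst w - 1, inv_into U \<phi> (snd w)) else w)"

definition level_end :: "nat \<Rightarrow> 'e \<times> bool \<Rightarrow> (nat \<times> 'e) \<times> bool" where
  "level_end k d = ((k, fst d), snd d)"

definition level_vertex :: "(nat \<times> 'e) \<times> bool \<Rightarrow> nat \<times> 'v" where
  "level_vertex x = vertex_name (fst (fst x), end_vertex H (snd (fst x), snd x))"

definition ends_upto :: "nat \<Rightarrow> ((nat \<times> 'e) \<times> bool) set" where
  "ends_upto n = ({1..n} \<times> arcs H) \<times> UNIV"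

lemma level_vertex_level_end [simp]: "level_vertex (level_end k d) = vertex_name (k, end_vertex H d)"
  by (simp add: level_vertex_def level_end_def)

lemma level_end_eq_iff [simp]: "level_end k d = level_end k' d' \<longleftrightarrow> k = k' \<and> d = d'"
  by (auto simp: level_end_def prod_eq_iff)

lemma level_end_in_ends_upto [simp]:
  "level_end k d \<in> ends_upto n \<longleftrightarrow> 1 \<le> k \<and> k \<le> n \<and> d \<in> edge_ends H"
  by (cases d) (auto simp: level_end_def ends_upto_def edge_ends_def)

lemma ends_upto_cases:
  assumes "x \<in> ends_upto n"
  obtains k d where "x = level_end k d" "1 \<le> k" "k \<le> n" "d \<in> edge_ends H"
  using assms by (auto simp: ends_upto_def level_end_def edge_ends_def)

lemma other_end_level_end: "other_end (level_end k d) = level_end k (other_end d)"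
  by (simp add: level_end_def other_end_def)

lemma finite_ends_upto: "finite (ends_upto n)"
  by (simp add: ends_upto_def)

lemma linear_family_structure:
  "verts (linear_family H U \<phi> (Suc n)) = {1} \<times> verts H \<union> {2..Suc n} \<times> (verts H - \<phi> ` U) \<and>
   arcs (linear_family H U \<phi> (Suc n)) = {1..Suc n} \<times> arcs H \<and>
   (\<forall>e \<in> arcs (linear_family H U \<phi> (Suc n)).
      tail (linear_family H U \<phi> (Suc n)) e = vertex_name (fst e, tail H (snd e)) \<and>
      head (linear_family H U \<phi> (Suc n)) e = vertex_name (fst e, head H (snd e)))"
proof (induction n)
  case 0
  then show ?case
    by (auto simp: graph_copy_def vertex_name_def)
next
  case (Suc n)
  let ?G = "linear_family H U \<phi> (Suc n)" and ?N = "Suc (Suc n)"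
  let ?m = "merged (Pair (Suc n) ` U) (\<lambda>v. (?N, \<phi> (snd v)))"
  have m: "?m (k, v) = (if k = ?N \<and> v \<in> \<phi> ` U then (Suc n, inv_into U \<phi> v) else (k, v))" for k v
    by (rule merged_level[OF inj])
  have m_low: "?m (vertex_name (k, v)) = vertex_name (k, v)" if "k \<le> Suc n" for k v
    using that by (auto simp: vertex_name_def m)
  have m_new: "?m (?N, v) = vertex_name (?N, v)" for v
    by (auto simp: vertex_name_def m)
  have V: "verts ?G = {1} \<times> verts H \<union> {2..Suc n} \<times> (verts H - \<phi> ` U)"
    using Suc.IH by (rule conjunct1)
  have A: "arcs ?G = {1..Suc n} \<times> arcs H"
    using Suc.IH[THEN conjunct2] by (rule conjunct1)
  have TH: "tail ?G e = vertex_name (fst e, tail H (snd e)) \<and>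
      head ?G e = vertex_name (fst e, head H (snd e))" if "e \<in> arcs ?G" for e
    using Suc.IH[THEN conjunct2, THEN conjunct2] that by (rule bspec)
  have m_id: "?m w = w" if "w \<in> verts ?G" for w
    using that unfolding V by (cases w) (auto simp: m)
  have "?m ` verts ?G = id ` verts ?G"
    by (rule image_cong[OF refl]) (simp only: m_id id_apply)
  then have m_old_verts: "?m ` verts ?G = verts ?G"
    by (simp only: image_id id_apply)
  have m_new_verts: "?m ` Pair ?N ` verts H = {?N} \<times> (verts H - \<phi> ` U) \<union> Pair (Suc n) ` U"
  proof (intro equalityI subsetI)
    fix w assume "w \<in> ?m ` Pair ?N ` verts H"
    then show "w \<in> {?N} \<times> (verts H - \<phi> ` U) \<union> Pair (Suc n) ` U"
      by (auto simp: m inv_in_U split: if_splits)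
  next
    fix w assume "w \<in> {?N} \<times> (verts H - \<phi> ` U) \<union> Pair (Suc n) ` U"
    then consider v where "w = (?N, v)" "v \<in> verts H - \<phi> ` U" | u where "w = (Suc n, u)" "u \<in> U"
      by auto
    then show "w \<in> ?m ` Pair ?N ` verts H"
    proof cases
      case 1
      then show ?thesis
        by (intro image_eqI[of _ _ "(?N, v)"]) (auto simp: m)
    next
      case 2
      then show ?thesis
        using image_verts inj by (intro image_eqI[of _ _ "(?N, \<phi> u)"]) (auto simp: m)
    qed
  qed
  have sub: "Pair (Suc n) ` U \<subseteq> verts ?G"
    unfolding V using U_verts disjoint by auto
  have "verts (linear_family H U \<phi> ?N) = ?m ` verts ?G \<union> ?m ` Pair ?N ` verts H"
    by (simp add: vertex_amalgamation_def self_amalgamation_def disjoint_union_def graph_copy_def image_Un)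
  also have "\<dots> = verts ?G \<union> {?N} \<times> (verts H - \<phi> ` U)"
    unfolding m_old_verts m_new_verts using sub by (simp only: Un_assoc[symmetric] Un_absorb1 Un_commute Un_left_commute)
  finally have "verts (linear_family H U \<phi> ?N) = verts ?G \<union> {?N} \<times> (verts H - \<phi> ` U)" .
  then have verts: "verts (linear_family H U \<phi> ?N) = {1} \<times> verts H \<union> {2..?N} \<times> (verts H - \<phi> ` U)"
    unfolding V by auto
  have arcs: "arcs (linear_family H U \<phi> ?N) = {1..?N} \<times> arcs H"
    by (auto simp: vertex_amalgamation_def self_amalgamation_def disjoint_union_def graph_copy_def A)
  have ends: "tail (linear_family H U \<phi> ?N) e = vertex_name (fst e, tail H (snd e)) \<and>
      head (linear_family H U \<phi> ?N) e = vertex_name (fst e, head H (snd e))" if e: "e \<in> {1..?N} \<times> arcs H" for e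
  proof (cases "e \<in> arcs ?G")
    case True
    then have "fst e \<le> Suc n"
      by (auto simp: A)
    with True show ?thesis
      by (simp add: vertex_amalgamation_def self_amalgamation_def disjoint_union_def TH m_low)
  next
    case False
    with e have "fst e = ?N"
      by (auto simp: A)
    with False show ?thesis
      by (simp add: vertex_amalgamation_def self_amalgamation_def disjoint_union_def graph_copy_def m_new)
  qed
  show ?case
    unfolding arcs by (intro conjI ballI verts refl ends)
qed

lemma end_vertex_linear_family:
  assumes "n \<ge> 1" "x \<in> ends_upto n"
  shows "end_vertex (linear_family H U \<phi> n) x = level_vertex x"
  using linear_family_structure[of "n - 1"] assms
  by (auto simp: end_vertex_def level_vertex_def ends_upto_def)

text \<open>The identification that closes the chain into a ring; \<open>n = 1\<close>, where first
  and last copy coincide, needs no special treatment.\<close>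

definition close_up :: "nat \<Rightarrow> nat \<times> 'v \<Rightarrow> nat \<times> 'v" where
  "close_up n w = (if fst w = 1 \<and> snd w \<in> \<phi> ` U then (n, inv_into U \<phi> (snd w)) else w)"

lemma circular_family_structure:
  "arcs (circular_family H U \<phi> n) = arcs (linear_family H U \<phi> n)"
  "verts (circular_family H U \<phi> n) = close_up n ` verts (linear_family H U \<phi> n)"
  "end_vertex (circular_family H U \<phi> n) x = close_up n (end_vertex (linear_family H U \<phi> n) x)"
proof -
  have "merged (Pair n ` U) (\<lambda>v. (1, \<phi> (snd v))) = close_up n"
    using merged_level[OF inj, of n 1] by (auto simp: fun_eq_iff close_up_def)
  then show "arcs (circular_family H U \<phi> n) = arcs (linear_family H U \<phi> n)"
    "verts (circular_family H U \<phi> n) = close_up n ` verts (linear_family H U \<phi> n)"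
    "end_vertex (circular_family H U \<phi> n) x = close_up n (end_vertex (linear_family H U \<phi> n) x)"
    by (simp_all add: circular_family_def self_amalgamation_def end_vertex_def)
qed

lemma verts_circular_family:
  assumes "n \<ge> 1"
  shows "verts (circular_family H U \<phi> n) = {1..n} \<times> (verts H - \<phi> ` U)"
proof -
  have V: "verts (linear_family H U \<phi> n) = {1} \<times> verts H \<union> {2..n} \<times> (verts H - \<phi> ` U)"
    using linear_family_structure[of "n - 1"] assms by simp
  show ?thesis
    unfolding circular_family_structure V
  proof (intro equalityI subsetI)
    fix w assume "w \<in> close_up n ` ({1} \<times> verts H \<union> {2..n} \<times> (verts H - \<phi> ` U))"
    then show "w \<in> {1..n} \<times> (verts H - \<phi> ` U)"
      using assms inv_in_U inv_not_in_image U_verts by (auto simp: close_up_def split: if_splits)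
  next
    fix w assume "w \<in> {1..n} \<times> (verts H - \<phi> ` U)"
    then show "w \<in> close_up n ` ({1} \<times> verts H \<union> {2..n} \<times> (verts H - \<phi> ` U))"
      by (intro image_eqI[of _ _ w]) (auto simp: close_up_def)
  qed
qed

lemma level_vertex_image:
  assumes "n \<ge> 1"
  shows "level_vertex ` ends_upto n = verts (linear_family H U \<phi> n)"
proof -
  have V: "verts (linear_family H U \<phi> n) = {1} \<times> verts H \<union> {2..n} \<times> (verts H - \<phi> ` U)"
    using linear_family_structure[of "n - 1"] assms by simp
  show ?thesis
    unfolding V
  proof (intro equalityI subsetI)
    fix w assume "w \<in> level_vertex ` ends_upto n"
    then obtain k d where "w = vertex_name (k, end_vertex H d)" "1 \<le> k" "k \<le> n" "d \<in> edge_ends H"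
      by (auto elim!: ends_upto_cases)
    then show "w \<in> {1} \<times> verts H \<union> {2..n} \<times> (verts H - \<phi> ` U)"
      using end_vertex_in_verts inv_in_U inv_not_in_image U_verts by (auto simp: vertex_name_def)
  next
    fix w assume w: "w \<in> {1} \<times> verts H \<union> {2..n} \<times> (verts H - \<phi> ` U)"
    obtain k v where kv: "w = (k, v)" by (cases w)
    obtain d where d: "d \<in> edge_ends H" "end_vertex H d = v"
      using ex_edge_end[of v] w kv by auto
    have "w = level_vertex (level_end k d)" "level_end k d \<in> ends_upto n"
      using w d kv assms by (auto simp: vertex_name_def)
    then show "w \<in> level_vertex ` ends_upto n"
      by blast
  qed
qed

text \<open>A copy of \<open>H\<close> that \<open>T\<close> meets lies in \<open>T\<close>
  entirely, as \<open>H\<close> is connected; consecutive copies share the vertex named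
  \<open>(k, u)\<close>, so this spreads in both directions.\<close>

lemma ends_upto_connected:
  assumes T: "T \<subseteq> ends_upto n" "T \<noteq> {}"
    and vertex: "\<And>x y. x \<in> T \<Longrightarrow> y \<in> ends_upto n \<Longrightarrow> level_vertex x = level_vertex y \<Longrightarrow> y \<in> T"
    and edge: "\<And>x. x \<in> T \<Longrightarrow> other_end x \<in> T"
  shows "T = ends_upto n"
proof -
  define full where "full k \<longleftrightarrow> (\<forall>d \<in> edge_ends H. level_end k d \<in> T)" for k
  have full: "full k" if k: "1 \<le> k" "k \<le> n" and d: "level_end k d \<in> T" "d \<in> edge_ends H" for k d
  proof -
    have "{d \<in> edge_ends H. level_end k d \<in> T} = edge_ends H"
    proof (rule edge_ends_connected[of _ d])
      fix d assume d: "d \<in> {d \<in> edge_ends H. level_end k d \<in> T}"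
      then show "other_end d \<in> {d \<in> edge_ends H. level_end k d \<in> T}"
        using edge[of "level_end k d"] other_end_in_edge_ends[of d H] by (simp add: other_end_level_end)
    next
      fix d d' assume d: "d \<in> {d \<in> edge_ends H. level_end k d \<in> T}" "d' \<in> edge_ends H"
        "end_vertex H d = end_vertex H d'"
      then show "d' \<in> {d \<in> edge_ends H. level_end k d \<in> T}"
        using vertex[of "level_end k d" "level_end k d'"] k by simp
    qed (use d in auto)
    then show ?thesis
      unfolding full_def by blast
  qed
  obtain u where u: "u \<in> U"
    using U_nonempty by blast
  obtain d1 where d1: "d1 \<in> edge_ends H" "end_vertex H d1 = u"
    using ex_edge_end u U_verts by blast
  obtain d2 where d2: "d2 \<in> edge_ends H" "end_vertex H d2 = \<phi> u"
    using ex_edge_end u image_verts by blast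
  have same: "level_vertex (level_end k d1) = level_vertex (level_end (Suc k) d2)" if "k \<ge> 1" for k
    using that u disjoint inj d1 d2 by (auto simp: vertex_name_def)
  have up: "full (Suc k)" if "1 \<le> k" "Suc k \<le> n" "full k" for k
  proof (rule full)
    have "level_end k d1 \<in> T"
      using that(3) d1(1) unfolding full_def by (rule bspec)
    then show "level_end (Suc k) d2 \<in> T"
      by (rule vertex[OF _ _ same[OF that(1)]]) (use that(2) d2(1) in simp)
  qed (use that d2(1) in simp_all)
  have down: "full k" if "1 \<le> k" "Suc k \<le> n" "full (Suc k)" for k
  proof (rule full)
    have "level_end (Suc k) d2 \<in> T"
      using that(3) d2(1) unfolding full_def by (rule bspec)
    then show "level_end k d1 \<in> T"
      by (rule vertex[OF _ _ same[OF that(1), symmetric]]) (use that(1,2) d1(1) in simp)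
  qed (use that d1(1) in simp_all)
  obtain x where x: "x \<in> T"
    using T by blast
  then have "x \<in> ends_upto n"
    using T(1) by blast
  then obtain k0 d0 where "x = level_end k0 d0" and k0': "1 \<le> k0" "k0 \<le> n" "d0 \<in> edge_ends H"
    by (rule ends_upto_cases)
  with x have k0: "level_end k0 d0 \<in> T" "1 \<le> k0" "k0 \<le> n" "d0 \<in> edge_ends H"
    by simp_all
  have up_all: "k \<le> n \<longrightarrow> full k" if "k0 \<le> k" for k
    using that
  proof (induction k rule: dec_induct)
    case base
    show ?case using full[OF k0(2,3,1,4)] by simp
  next
    case (step k)
    then show ?case using up[of k] k0 by auto
  qed
  have down_all: "1 \<le> k \<longrightarrow> full k" if "k \<le> k0" for k
    using that
  proof (induction k rule: inc_induct)
    case base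
    show ?case using full[OF k0(2,3,1,4)] by simp
  next
    case (step k)
    then show ?case using down[of k] k0 by auto
  qed
  have "full k" if "1 \<le> k" "k \<le> n" for k
    using up_all[of k] down_all[of k] that by (cases "k0 \<le> k") auto
  then have "y \<in> T" if "y \<in> ends_upto n" for y
    using that unfolding full_def by (elim ends_upto_cases) simp
  with T(1) show ?thesis by blast
qed

subsection \<open>The transfer matrix\<close>

definition open_ends :: "(bool \<times> 'e \<times> bool) set" where
  "open_ends = {False} \<times> {d \<in> edge_ends H. end_vertex H d \<in> U \<union> \<phi> ` U}"

definition new_ends :: "(bool \<times> 'e \<times> bool) set" where
  "new_ends = {True} \<times> edge_ends H"

text \<open>\<open>(False, d)\<close> stands for the end \<open>d\<close> at a gluing vertex of the first or of the last copy in the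
  \<open>n\<close>-th graph, according to whether \<open>d\<close> sits at \<open>\<phi> ` U\<close> or at \<open>U\<close>; \<open>(True, d)\<close> stands for the
  end \<open>d\<close> in the next copy.\<close>
definition place :: "nat \<Rightarrow> bool \<times> 'e \<times> bool \<Rightarrow> (nat \<times> 'e) \<times> bool" where
  "place n x = level_end (if fst x then Suc n else if end_vertex H (snd x) \<in> \<phi> ` U then 1 else n) (snd x)"

definition advance :: "bool \<times> 'e \<times> bool \<Rightarrow> bool \<times> 'e \<times> bool" where
  "advance x = (end_vertex H (snd x) \<notin> \<phi> ` U, snd x)"

text \<open>The ends at vertices that no later gluing and no closing up will touch; their rotation
  can be fixed for good.\<close>

definition closed_ends :: "nat \<Rightarrow> ((nat \<times> 'e) \<times> bool) set" where
  "closed_ends n = ends_upto n - place n ` open_ends"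

definition flip :: "nat \<Rightarrow> (nat \<times> 'e) \<times> bool \<Rightarrow> (nat \<times> 'e) \<times> bool" where
  "flip n x = (if x \<in> ends_upto n then other_end x else x)"

definition new_flip :: "bool \<times> 'e \<times> bool \<Rightarrow> bool \<times> 'e \<times> bool" where
  "new_flip x = (if x \<in> new_ends then (True, other_end (snd x)) else x)"

text \<open>A stand-in, free of \<open>n\<close>, for the vertex of an end being closed:
  \<open>False\<close> means copy \<open>n\<close>, \<open>True\<close> means copy
  \<open>n + 1\<close>, and \<open>\<phi> u\<close> in the new copy is \<open>u\<close> in copy
  \<open>n\<close>.\<close>

definition new_vertex :: "bool \<times> 'e \<times> bool \<Rightarrow> bool \<times> 'v" where
  "new_vertex x = (if fst x \<and> end_vertex H (snd x) \<in> \<phi> ` U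
     then (False, inv_into U \<phi> (end_vertex H (snd x))) else (fst x, end_vertex H (snd x)))"

text \<open>The polynomial \<open>Z\<^sub>n(\<kappa>)\<close> of the introduction, for \<open>\<kappa>\<close> a permutation of \<open>open_ends\<close>.\<close>
definition partial_sum :: "nat \<Rightarrow> (bool \<times> 'e \<times> bool \<Rightarrow> bool \<times> 'e \<times> bool) \<Rightarrow> int poly" where
  "partial_sum n \<kappa> = (\<Sum>\<rho>\<in>rotations (closed_ends n) level_vertex.
     monom 1 (transposition_length (ends_upto n) (map_permutation open_ends (place n) \<kappa> \<circ> (\<rho> \<circ> flip n))))"

lemma finite_open_ends: "finite open_ends" and finite_new_ends: "finite new_ends"
  and open_new_disjoint: "open_ends \<inter> new_ends = {}"
  using finite_edge_ends by (auto simp: open_ends_def new_ends_def)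

lemma flip_permutes: "flip n permutes ends_upto n"
proof (rule bij_imp_permutes)
  show "bij_betw (flip n) (ends_upto n) (ends_upto n)"
    by (rule bij_betw_byWitness[where f' = "flip n"])
      (auto simp: flip_def ends_upto_def other_end_def)
qed (simp add: flip_def)

lemma new_flip_permutes: "new_flip permutes new_ends"
proof (rule bij_imp_permutes)
  show "bij_betw new_flip new_ends new_ends"
    by (rule bij_betw_byWitness[where f' = new_flip])
      (auto simp: new_flip_def new_ends_def edge_ends_def other_end_def)
qed (simp add: new_flip_def)

text \<open>The end \<open>d\<close> itself is never forgotten, so only the tag could be lost; for
  \<open>n \<ge> 1\<close> the new copy \<open>Suc n\<close> differs from both \<open>1\<close> and
  \<open>n\<close>.\<close>

lemma place_inj:
  assumes "n \<ge> 1"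
  shows "inj_on (place n) (open_ends \<union> new_ends)"
  using assms by (auto simp: inj_on_def place_def open_ends_def new_ends_def)

lemma place_new_ends: "place n ` new_ends = level_end (Suc n) ` edge_ends H"
  by (force simp: place_def new_ends_def)

lemma place_open_ends:
  assumes "n \<ge> 1"
  shows "place n ` open_ends \<subseteq> ends_upto n"
  using assms by (auto simp: place_def open_ends_def)

lemma ends_upto_Suc: "ends_upto (Suc n) = ends_upto n \<union> place n ` new_ends"
proof (intro equalityI subsetI)
  fix x assume "x \<in> ends_upto (Suc n)"
  then show "x \<in> ends_upto n \<union> place n ` new_ends"
    unfolding place_new_ends by (cases rule: ends_upto_cases) (auto simp: le_Suc_eq)
next
  fix x assume "x \<in> ends_upto n \<union> place n ` new_ends"
  then show "x \<in> ends_upto (Suc n)"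
    unfolding place_new_ends by (auto elim!: ends_upto_cases)
qed

lemma new_ends_not_upto: "ends_upto n \<inter> place n ` new_ends = {}"
  unfolding place_new_ends by auto

lemma advance_open_ends: "advance ` open_ends \<subseteq> open_ends \<union> new_ends"
  by (auto simp: advance_def open_ends_def new_ends_def)

lemma place_Suc:
  assumes "x \<in> open_ends"
  shows "place (Suc n) x = place n (advance x)"
  using assms by (auto simp: place_def advance_def open_ends_def)

lemma place_Suc_image: "place (Suc n) ` open_ends = place n ` advance ` open_ends"
  unfolding image_image by (rule image_cong[OF refl]) (rule place_Suc)

text \<open>Old ends at \<open>U\<close> together with new ends outside \<open>U\<close>: exactly
  the ends whose vertex becomes complete when the copy is glued on.\<close>

definition inner_ends :: "(bool \<times> 'e \<times> bool) set" where
  "inner_ends = open_ends \<union> new_ends - advance ` open_ends"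

lemma closed_ends_Suc:
  assumes "n \<ge> 1"
  shows "closed_ends (Suc n) = closed_ends n \<union> place n ` inner_ends"
    and "closed_ends n \<inter> place n ` (open_ends \<union> new_ends) = {}"
proof -
  show disj: "closed_ends n \<inter> place n ` (open_ends \<union> new_ends) = {}"
    using new_ends_not_upto[of n] unfolding closed_ends_def image_Un by blast
  have inner: "place n ` inner_ends = place n ` (open_ends \<union> new_ends) - place n ` advance ` open_ends"
    unfolding inner_ends_def
    by (rule inj_on_image_set_diff[OF place_inj[OF assms]]) (use advance_open_ends in auto)
  have sub: "place n ` advance ` open_ends \<subseteq> place n ` (open_ends \<union> new_ends)"
    using advance_open_ends by (rule image_mono)
  have ends: "ends_upto n \<union> place n ` new_ends = closed_ends n \<union> place n ` (open_ends \<union> new_ends)"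
    using place_open_ends[OF assms] unfolding closed_ends_def image_Un by blast
  have "closed_ends (Suc n) = ends_upto n \<union> place n ` new_ends - place n ` advance ` open_ends"
    unfolding closed_ends_def ends_upto_Suc place_Suc_image ..
  also have "\<dots> = (closed_ends n - place n ` advance ` open_ends) \<union> place n ` inner_ends"
    unfolding ends inner by (rule Un_Diff)
  also have "closed_ends n - place n ` advance ` open_ends = closed_ends n"
    using disj sub by (intro Diff_triv) blast
  finally show "closed_ends (Suc n) = closed_ends n \<union> place n ` inner_ends" .
qed

text \<open>Keeps closed vertices apart from the open ones, \<open>(1, \<phi> u)\<close> and
  \<open>(n, u)\<close>, and from everything in later copies. This is the separation that makes
  rotations factor.\<close>

lemma closed_vertex:
  assumes "x \<in> closed_ends n" "level_vertex x = (k, v)"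
  shows "v \<notin> \<phi> ` U" "k \<le> n" "k = n \<Longrightarrow> v \<notin> U"
proof -
  have "x \<in> ends_upto n"
    using assms(1) by (simp add: closed_ends_def)
  then obtain l d where x: "x = level_end l d" "1 \<le> l" "l \<le> n" "d \<in> edge_ends H"
    by (rule ends_upto_cases)
  have "level_end l d \<notin> place n ` open_ends"
    using assms(1) x(1) by (simp add: closed_ends_def)
  then have not_placed: "place n (False, d) \<noteq> level_end l d \<or> end_vertex H d \<notin> U \<union> \<phi> ` U"
    using x(4) unfolding open_ends_def by force
  have eq: "vertex_name (l, end_vertex H d) = (k, v)"
    using assms(2) x(1) by simp
  have "v \<notin> \<phi> ` U \<and> k \<le> n \<and> (k = n \<longrightarrow> v \<notin> U)"
  proof (cases "2 \<le> l \<and> end_vertex H d \<in> \<phi> ` U")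
    case True
    then have "k = l - 1" "v = inv_into U \<phi> (end_vertex H d)"
      using eq by (simp_all add: vertex_name_def)
    moreover from this have "k < n"
      using True x(3) by linarith
    ultimately show ?thesis
      using True inv_not_in_image by simp
  next
    case False
    then have kv: "k = l" "v = end_vertex H d"
      using eq by (auto simp: vertex_name_def split: if_splits)
    have "v \<notin> \<phi> ` U"
    proof
      assume v: "v \<in> \<phi> ` U"
      then have "l = 1"
        using False kv x(2) by simp
      then show False
        using not_placed v kv by (simp add: place_def)
    qed
    moreover have "v \<notin> U" if "k = n"
      using not_placed kv that calculation by (auto simp: place_def)
    ultimately show ?thesis
      using kv x(3) by simp
  qed
  then show "v \<notin> \<phi> ` U" "k \<le> n" "k = n \<Longrightarrow> v \<notin> U"
    by simp_all
qed

text \<open>The first claim makes the fibres on \<open>inner_ends\<close> independent of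
  \<open>n\<close>; the second, against \<open>closed_vertex\<close>, shows that these vertices
  contain no closed ends.\<close>

lemma inner_vertex:
  assumes "n \<ge> 1" "x \<in> inner_ends"
  shows "level_vertex (place n x) = (if fst (new_vertex x) then Suc n else n, snd (new_vertex x))"
    and "snd (new_vertex x) \<in> U \<or> fst (new_vertex x)"
proof -
  obtain s d where x: "x = (s, d)" by (cases x)
  have not_image: "x \<notin> advance ` open_ends" and x_cases: "x \<in> open_ends \<or> x \<in> new_ends"
    using assms(2) by (simp_all add: inner_ends_def)
  have d: "d \<in> edge_ends H"
    using x_cases by (auto simp: x open_ends_def new_ends_def)
  have not_advance: "x \<noteq> advance (False, d)" if "end_vertex H d \<in> U \<union> \<phi> ` U"
  proof
    assume "x = advance (False, d)"
    moreover have "(False, d) \<in> open_ends"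
      using d that by (simp add: open_ends_def)
    ultimately show False
      using not_image by blast
  qed
  have s: "s \<and> end_vertex H d \<notin> U \<or> \<not> s \<and> end_vertex H d \<in> U"
  proof (cases s)
    case True
    have "end_vertex H d \<notin> U"
    proof
      assume u: "end_vertex H d \<in> U"
      then have "x = advance (False, d)"
        using True U_not_in_image[OF u] by (simp add: x advance_def)
      with not_advance u show False by simp
    qed
    with True show ?thesis by simp
  next
    case False
    then have "end_vertex H d \<in> U \<union> \<phi> ` U"
      using x_cases by (simp add: x open_ends_def new_ends_def)
    moreover have "end_vertex H d \<notin> \<phi> ` U"
    proof
      assume v: "end_vertex H d \<in> \<phi> ` U"
      then have "x = advance (False, d)"
        using False by (simp add: x advance_def)
      with not_advance v show False by simp
    qed
    ultimately show ?thesis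
      using False by simp
  qed
  show "level_vertex (place n x) = (if fst (new_vertex x) then Suc n else n, snd (new_vertex x))"
    using s
  proof
    assume "s \<and> end_vertex H d \<notin> U"
    then show ?thesis
      using assms(1) by (simp add: x place_def vertex_name_def new_vertex_def)
  next
    assume s: "\<not> s \<and> end_vertex H d \<in> U"
    then have "end_vertex H d \<notin> \<phi> ` U"
      using U_not_in_image by blast
    with s show ?thesis
      by (simp add: x place_def vertex_name_def new_vertex_def)
  qed
  show "snd (new_vertex x) \<in> U \<or> fst (new_vertex x)"
  proof (cases "s \<and> end_vertex H d \<in> \<phi> ` U")
    case True
    then show ?thesis
      using inv_in_U by (simp add: x new_vertex_def)
  next
    case False
    then show ?thesis
      using s by (auto simp: x new_vertex_def)
  qed
qed

lemma open_vertex: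
  assumes "n \<ge> 1" "x \<in> open_ends"
  shows "level_vertex (place n x) =
    (if end_vertex H (snd x) \<in> \<phi> ` U then 1 else n, end_vertex H (snd x))"
proof -
  have "end_vertex H (snd x) \<in> U \<union> \<phi> ` U" "\<not> fst x"
    using assms(2) by (auto simp: open_ends_def)
  then show ?thesis
    by (auto simp: place_def vertex_name_def)
qed

text \<open>The new copy of \<open>H\<close>, its rotation and \<open>\<kappa>\<close> act together on the open ends of the \<open>n\<close>-th graph
  as a single permutation that does not depend on \<open>n\<close>.\<close>
lemma partial_sum_recurrence:
  "\<exists>M. \<forall>\<kappa> n. \<kappa> permutes open_ends \<longrightarrow> n \<ge> 1 \<longrightarrow>
     partial_sum (Suc n) \<kappa> = (\<Sum>\<kappa>' | \<kappa>' permutes open_ends. M \<kappa> \<kappa>' * partial_sum n \<kappa>')"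
proof -
  let ?B = "open_ends \<union> new_ends"
  let ?K = "rotations inner_ends new_vertex"
  \<comment> \<open>All factors of the face permutation of graph \<open>n + 1\<close> that involve
    the new copy, written on tagged ends so that \<open>n\<close> does not occur.\<close>
  define \<theta> where "\<theta> \<kappa> \<sigma> = map_permutation open_ends advance \<kappa> \<circ> \<sigma> \<circ> new_flip" for \<kappa> \<sigma>
  have inner_B: "inner_ends \<subseteq> ?B"
    by (auto simp: inner_ends_def)
  have fin_inner: "finite inner_ends"
    using finite_open_ends finite_new_ends by (simp add: inner_ends_def)
  have adv_inj: "inj_on advance open_ends"
    by (auto simp: inj_on_def advance_def open_ends_def)
  have \<kappa>': "map_permutation open_ends advance \<kappa> permutes advance ` open_ends" if "\<kappa> permutes open_ends" for \<kappa>
    using adv_inj that by (rule map_permutation_permutes_image)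
  have \<theta>: "\<theta> \<kappa> \<sigma> permutes ?B" if "\<kappa> permutes open_ends" "\<sigma> \<in> ?K" for \<kappa> \<sigma>
    unfolding \<theta>_def
    by (intro permutes_compose permutes_subset[OF \<kappa>'[OF that(1)] advance_open_ends]
      permutes_subset[OF rotations_permutes[OF that(2)] inner_B] permutes_subset[OF new_flip_permutes] Un_upper2)
  \<comment> \<open>One pair of a permutation and a shift has to serve all \<open>n\<close> and
    \<gamma> at once; choosing it from \<theta> only keeps \<open>M\<close> free of
    \<open>n\<close>.\<close>
  define good where "good \<theta> p \<longleftrightarrow> fst p permutes open_ends \<and> (\<forall>n \<gamma>. n \<ge> 1 \<longrightarrow> \<gamma> permutes ends_upto n \<longrightarrow>
      transposition_length (ends_upto (Suc n)) (map_permutation ?B (place n) \<theta> \<circ> \<gamma>) =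
      transposition_length (ends_upto n) (map_permutation open_ends (place n) (fst p) \<circ> \<gamma>) + snd p)"
    for \<theta> and p :: "(bool \<times> 'e \<times> bool \<Rightarrow> bool \<times> 'e \<times> bool) \<times> nat"
  have good_perm: "fst p permutes open_ends" if "good \<theta> p" for \<theta> p
    using that unfolding good_def by (rule conjunct1)
  have good_len: "transposition_length (ends_upto (Suc n)) (map_permutation ?B (place n) \<theta> \<circ> \<gamma>) =
      transposition_length (ends_upto n) (map_permutation open_ends (place n) (fst p) \<circ> \<gamma>) + snd p"
    if "good \<theta> p" "n \<ge> 1" "\<gamma> permutes ends_upto n" for \<theta> p n \<gamma>
    using that(1)[unfolded good_def, THEN conjunct2, rule_format, OF that(2,3)] .
  have good_ex: "\<exists>p. good \<theta> p" if perm_B: "\<theta> permutes ?B" for \<theta>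
  proof -
    obtain \<theta>' m where perm: "\<theta>' permutes open_ends" and
      len: "\<forall>(f :: _ \<Rightarrow> (nat \<times> 'e) \<times> bool) A \<gamma>. inj_on f ?B \<longrightarrow> finite A \<longrightarrow> A \<inter> f ` ?B = f ` open_ends \<longrightarrow>
        \<gamma> permutes A \<longrightarrow> transposition_length (A \<union> f ` new_ends) (map_permutation ?B f \<theta> \<circ> \<gamma>) =
        transposition_length A (map_permutation open_ends f \<theta>' \<circ> \<gamma>) + m"
      using absorb_permutation[OF finite_new_ends finite_open_ends open_new_disjoint perm_B]
      by (elim exE conjE) (rule that)
    have "good \<theta> (\<theta>', m)"
      unfolding good_def fst_conv snd_conv
    proof (intro conjI allI impI perm)
      fix n :: nat and \<gamma> assume n: "n \<ge> 1" and \<gamma>: "\<gamma> permutes ends_upto n"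
      have "ends_upto n \<inter> place n ` ?B = place n ` open_ends"
        using place_open_ends[OF n] new_ends_not_upto[of n] unfolding image_Un by blast
      from len[rule_format, OF place_inj[OF n] finite_ends_upto this \<gamma>]
      show "transposition_length (ends_upto (Suc n)) (map_permutation ?B (place n) \<theta> \<circ> \<gamma>) =
          transposition_length (ends_upto n) (map_permutation open_ends (place n) \<theta>' \<circ> \<gamma>) + m"
        unfolding ends_upto_Suc .
    qed
    then show ?thesis by blast
  qed
  define r where "r \<theta> = (SOME p. good \<theta> p)" for \<theta>
  have r: "good \<theta> (r \<theta>)" if "\<theta> permutes ?B" for \<theta>
    unfolding r_def by (rule someI_ex[OF good_ex[OF that]])
  \<comment> \<open>Each rotation \<sigma> of the newly completed vertices sends the state \<kappa>
    to one state and contributes \<open>y\<close> to the shift.\<close>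
  define M where "M \<kappa> \<kappa>' = (\<Sum>\<sigma>\<in>?K. if fst (r (\<theta> \<kappa> \<sigma>)) = \<kappa>' then monom (1 :: int) (snd (r (\<theta> \<kappa> \<sigma>))) else 0)" for \<kappa> \<kappa>'
  have "partial_sum (Suc n) \<kappa> = (\<Sum>\<kappa>' | \<kappa>' permutes open_ends. M \<kappa> \<kappa>' * partial_sum n \<kappa>')"
    if \<kappa>: "\<kappa> permutes open_ends" and n: "n \<ge> 1" for \<kappa> n
  proof -
    let ?R = "rotations (closed_ends n) level_vertex"
    let ?len = "\<lambda>\<tau>. monom (1 :: int) (transposition_length (ends_upto (Suc n))
        (map_permutation open_ends (place (Suc n)) \<kappa> \<circ> (\<tau> \<circ> flip (Suc n))))"
    have inj: "inj_on (place n) ?B"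
      using n by (rule place_inj)
    have disj: "closed_ends n \<inter> place n ` inner_ends = {}"
      using closed_ends_Suc(2)[OF n] inner_B by blast
    have vdisj: "level_vertex ` closed_ends n \<inter> level_vertex ` place n ` inner_ends = {}"
    proof -
      have "level_vertex x \<noteq> level_vertex (place n y)" if "x \<in> closed_ends n" "y \<in> inner_ends" for x y
      proof
        assume "level_vertex x = level_vertex (place n y)"
        then have eq: "level_vertex x = (if fst (new_vertex y) then Suc n else n, snd (new_vertex y))"
          using inner_vertex(1)[OF n that(2)] by simp
        show False
          using closed_vertex(2,3)[OF that(1) eq] inner_vertex(2)[OF n that(2)]
          by (cases "fst (new_vertex y)") simp_all
      qed
      then show ?thesis by blast
    qed
    have kernel: "level_vertex (place n x) = level_vertex (place n y) \<longleftrightarrow> new_vertex x = new_vertex y"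
      if "x \<in> inner_ends" "y \<in> inner_ends" for x y
      by (simp add: inner_vertex(1)[OF n that(1)] inner_vertex(1)[OF n that(2)] prod_eq_iff)
    have fin: "finite (closed_ends n \<union> place n ` inner_ends)"
      using finite_ends_upto[of n] fin_inner by (simp add: closed_ends_def)
    have "partial_sum (Suc n) \<kappa> = (\<Sum>\<rho>\<in>?R. \<Sum>\<tau>\<in>rotations (place n ` inner_ends) level_vertex. ?len (\<tau> \<circ> \<rho>))"
      unfolding partial_sum_def closed_ends_Suc(1)[OF n] by (rule sum_rotations_union[OF fin disj vdisj])
    also have "\<dots> = (\<Sum>\<rho>\<in>?R. \<Sum>\<sigma>\<in>?K. ?len (map_permutation inner_ends (place n) \<sigma> \<circ> \<rho>))"
      by (intro sum.cong refl sum_rotations_image inj_on_subset[OF inj inner_B] kernel)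
    also have "\<dots> = (\<Sum>\<rho>\<in>?R. \<Sum>\<sigma>\<in>?K. monom 1 (snd (r (\<theta> \<kappa> \<sigma>))) *
        monom 1 (transposition_length (ends_upto n)
          (map_permutation open_ends (place n) (fst (r (\<theta> \<kappa> \<sigma>))) \<circ> (\<rho> \<circ> flip n))))"
    proof (intro sum.cong refl)
      fix \<rho> \<sigma> assume \<rho>: "\<rho> \<in> ?R" and \<sigma>: "\<sigma> \<in> ?K"
      have \<rho>_perm: "\<rho> permutes closed_ends n"
        using \<rho> by (rule rotations_permutes)
      have \<sigma>_perm: "\<sigma> permutes inner_ends"
        using \<sigma> by (rule rotations_permutes)
      let ?p = "map_permutation ?B (place n)"
      \<comment> \<open>By \<open>place_Suc\<close>, placing \<kappa> at level \<open>n + 1\<close>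
        amounts to advancing it first and placing it at level \<open>n\<close>.\<close>
      have 1: "map_permutation open_ends (place (Suc n)) \<kappa> = ?p (map_permutation open_ends advance \<kappa>)"
      proof -
        have bij: "bij_betw advance open_ends (advance ` open_ends)"
          using adv_inj by (simp add: bij_betw_def)
        have "?p (map_permutation open_ends advance \<kappa>) =
            map_permutation (advance ` open_ends) (place n) (map_permutation open_ends advance \<kappa>)"
          by (rule map_permutation_superset[OF \<kappa>'[OF \<kappa>] advance_open_ends inj])
        also have "\<dots> = map_permutation open_ends (place n \<circ> advance) \<kappa>"
          by (rule map_permutation_compose[OF bij inj_on_subset[OF inj advance_open_ends]])
        also have "\<dots> = map_permutation open_ends (place (Suc n)) \<kappa>"
          by (rule map_permutation_cong[OF comp_inj_on[OF adv_inj inj_on_subset[OF inj advance_open_ends]] \<kappa> refl])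
            (simp_all add: place_Suc)
        finally show ?thesis by (rule sym)
      qed
      have 2: "map_permutation inner_ends (place n) \<sigma> = ?p \<sigma>"
        by (rule map_permutation_superset[OF \<sigma>_perm inner_B inj, symmetric])
      have flip_new: "?p new_flip = map_permutation new_ends (place n) new_flip"
        by (rule map_permutation_superset[OF new_flip_permutes _ inj]) simp
      have flip_new_perm: "?p new_flip permutes place n ` new_ends"
        unfolding flip_new
        by (rule map_permutation_permutes_image[OF inj_on_subset[OF inj] new_flip_permutes]) simp
      have 3: "flip (Suc n) = ?p new_flip \<circ> flip n"
      proof
        fix x
        show "flip (Suc n) x = (?p new_flip \<circ> flip n) x"
        proof (cases "x \<in> place n ` new_ends")
          case True
          then obtain y where y: "y \<in> new_ends" "x = place n y" by blast
          have "flip n x = x"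
            using True new_ends_not_upto[of n] by (auto simp: flip_def)
          moreover have "?p new_flip x = place n (new_flip y)"
            unfolding y(2) using y(1) by (intro map_permutation_apply[OF inj]) simp
          moreover have "x \<in> ends_upto (Suc n)"
            using True by (simp add: ends_upto_Suc)
          ultimately show ?thesis
            using y by (auto simp: flip_def new_flip_def new_ends_def place_def other_end_level_end)
        next
          case False
          then have "flip n x \<notin> place n ` new_ends"
            using permutes_in_image[OF flip_permutes, of n x] new_ends_not_upto[of n]
            by (auto simp: flip_def)
          then have "?p new_flip (flip n x) = flip n x"
            by (rule permutes_not_in[OF flip_new_perm])
          then show ?thesis
            using False by (simp add: flip_def ends_upto_Suc)
        qed
      qed
      \<comment> \<open>The old rotation \<rho> stands between the new factors. It moves only closed
        ends, so the new flip commutes past it, and \<theta> collects to the left of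
        \<open>\<rho> \<circ> flip n\<close>.\<close>
      have 4: "?p new_flip \<circ> \<rho> = \<rho> \<circ> ?p new_flip"
        by (rule permutes_disjoint_commute[OF flip_new_perm \<rho>_perm])
          (use closed_ends_Suc(2)[OF n] in blast)
      have \<sigma>_B: "\<sigma> permutes ?B"
        using \<sigma>_perm inner_B by (rule permutes_subset)
      have flip_B: "new_flip permutes ?B"
        using new_flip_permutes by (rule permutes_subset) simp
      have 5: "?p (\<theta> \<kappa> \<sigma>) = ?p (map_permutation open_ends advance \<kappa>) \<circ> ?p \<sigma> \<circ> ?p new_flip"
        unfolding \<theta>_def map_permutation_compose'[OF inj flip_B] map_permutation_compose'[OF inj \<sigma>_B] ..
      have "map_permutation open_ends (place (Suc n)) \<kappa> \<circ>
          ((map_permutation inner_ends (place n) \<sigma> \<circ> \<rho>) \<circ> flip (Suc n)) =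
          ?p (map_permutation open_ends advance \<kappa>) \<circ> ?p \<sigma> \<circ> (\<rho> \<circ> ?p new_flip) \<circ> flip n"
        unfolding 1 2 3 by (simp only: comp_assoc)
      also have "\<dots> = ?p (\<theta> \<kappa> \<sigma>) \<circ> (\<rho> \<circ> flip n)"
        unfolding 4[symmetric] 5 by (simp only: comp_assoc)
      finally have eq: "map_permutation open_ends (place (Suc n)) \<kappa> \<circ>
          ((map_permutation inner_ends (place n) \<sigma> \<circ> \<rho>) \<circ> flip (Suc n)) =
          ?p (\<theta> \<kappa> \<sigma>) \<circ> (\<rho> \<circ> flip n)" .
      have "\<rho> \<circ> flip n permutes ends_upto n"
        by (rule permutes_compose[OF flip_permutes permutes_subset[OF \<rho>_perm]]) (auto simp: closed_ends_def)
      then have len: "transposition_length (ends_upto (Suc n)) (?p (\<theta> \<kappa> \<sigma>) \<circ> (\<rho> \<circ> flip n)) =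
          transposition_length (ends_upto n)
            (map_permutation open_ends (place n) (fst (r (\<theta> \<kappa> \<sigma>))) \<circ> (\<rho> \<circ> flip n)) + snd (r (\<theta> \<kappa> \<sigma>))"
        using good_len[OF r[OF \<theta>[OF \<kappa> \<sigma>]] n] by blast
      show "?len (map_permutation inner_ends (place n) \<sigma> \<circ> \<rho>) = monom 1 (snd (r (\<theta> \<kappa> \<sigma>))) *
        monom 1 (transposition_length (ends_upto n)
          (map_permutation open_ends (place n) (fst (r (\<theta> \<kappa> \<sigma>))) \<circ> (\<rho> \<circ> flip n)))"
        unfolding eq len mult_monom by (simp add: add.commute)
    qed
    also have "\<dots> = (\<Sum>\<sigma>\<in>?K. monom 1 (snd (r (\<theta> \<kappa> \<sigma>))) * partial_sum n (fst (r (\<theta> \<kappa> \<sigma>))))"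
      unfolding partial_sum_def sum_distrib_left by (rule sum.swap)
    also have "\<dots> = (\<Sum>\<sigma>\<in>?K. \<Sum>\<kappa>' | \<kappa>' permutes open_ends.
        (if fst (r (\<theta> \<kappa> \<sigma>)) = \<kappa>' then monom 1 (snd (r (\<theta> \<kappa> \<sigma>))) else 0) * partial_sum n \<kappa>')"
    proof (intro sum.cong refl)
      fix \<sigma> assume "\<sigma> \<in> ?K"
      then have perm: "fst (r (\<theta> \<kappa> \<sigma>)) \<in> {\<kappa>'. \<kappa>' permutes open_ends}"
        using good_perm[OF r[OF \<theta>[OF \<kappa>]]] by simp
      have "(\<Sum>\<kappa>' | \<kappa>' permutes open_ends.
          (if fst (r (\<theta> \<kappa> \<sigma>)) = \<kappa>' then monom 1 (snd (r (\<theta> \<kappa> \<sigma>))) else 0) * partial_sum n \<kappa>') =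
          (\<Sum>\<kappa>' | \<kappa>' permutes open_ends.
          (if fst (r (\<theta> \<kappa> \<sigma>)) = \<kappa>' then monom 1 (snd (r (\<theta> \<kappa> \<sigma>))) * partial_sum n \<kappa>' else 0))"
        by (intro sum.cong) auto
      also have "\<dots> = monom 1 (snd (r (\<theta> \<kappa> \<sigma>))) * partial_sum n (fst (r (\<theta> \<kappa> \<sigma>)))"
        using perm finite_permutations[OF finite_open_ends] by (subst sum.delta') auto
      finally show "monom 1 (snd (r (\<theta> \<kappa> \<sigma>))) * partial_sum n (fst (r (\<theta> \<kappa> \<sigma>))) =
          (\<Sum>\<kappa>' | \<kappa>' permutes open_ends.
          (if fst (r (\<theta> \<kappa> \<sigma>)) = \<kappa>' then monom 1 (snd (r (\<theta> \<kappa> \<sigma>))) else 0) * partial_sum n \<kappa>')"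
        by (rule sym)
    qed
    also have "\<dots> = (\<Sum>\<kappa>' | \<kappa>' permutes open_ends. M \<kappa> \<kappa>' * partial_sum n \<kappa>')"
      unfolding M_def sum_distrib_right by (rule sum.swap)
    finally show ?thesis .
  qed
  then show ?thesis
    by (intro exI[of _ M] allI impI)
qed

subsection \<open>Closing the open ends\<close>

text \<open>In the finished graph the open ends do carry genuine rotations. By
  \<open>separate\<close> these are independent of the closed part, and by \<open>kernel\<close>
  they form a set that does not change with \<open>n\<close>.\<close>

lemma sum_rotations_ends_upto:
  assumes n: "n \<ge> 1"
    and closed: "\<And>x. x \<in> closed_ends n \<Longrightarrow> h x = level_vertex x"
    and separate: "h ` closed_ends n \<inter> h ` place n ` open_ends = {}"
    and kernel: "\<And>x y. x \<in> open_ends \<Longrightarrow> y \<in> open_ends \<Longrightarrow> h (place n x) = h (place n y) \<longleftrightarrow> h0 x = h0 y"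
  shows "(\<Sum>\<sigma>\<in>rotations (ends_upto n) h. monom 1 (transposition_length (ends_upto n) (\<sigma> \<circ> flip n))) =
    (\<Sum>\<kappa>\<in>rotations open_ends h0. partial_sum n \<kappa>)"
proof -
  let ?g = "\<lambda>\<sigma>. monom (1 :: int) (transposition_length (ends_upto n) (\<sigma> \<circ> flip n))"
  have split: "ends_upto n = closed_ends n \<union> place n ` open_ends"
    using place_open_ends[OF n] by (auto simp: closed_ends_def)
  have disj: "closed_ends n \<inter> place n ` open_ends = {}"
    by (auto simp: closed_ends_def)
  have fin: "finite (closed_ends n \<union> place n ` open_ends)"
    using finite_ends_upto[of n] by (simp only: split)
  have same: "rotations (closed_ends n) h = rotations (closed_ends n) level_vertex"
    by (rule rotations_cong) (simp add: closed)
  have inj: "inj_on (place n) open_ends"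
    using place_inj[OF n] by (rule inj_on_subset) simp
  have "(\<Sum>\<sigma>\<in>rotations (ends_upto n) h. ?g \<sigma>) =
      (\<Sum>\<sigma>\<in>rotations (closed_ends n \<union> place n ` open_ends) h. ?g \<sigma>)"
    by (simp only: split[symmetric])
  also have "\<dots> = (\<Sum>\<rho>\<in>rotations (closed_ends n) h. \<Sum>\<tau>\<in>rotations (place n ` open_ends) h. ?g (\<tau> \<circ> \<rho>))"
    by (rule sum_rotations_union[OF fin disj separate])
  also have "\<dots> = (\<Sum>\<rho>\<in>rotations (closed_ends n) level_vertex. \<Sum>\<kappa>\<in>rotations open_ends h0.
      ?g (map_permutation open_ends (place n) \<kappa> \<circ> \<rho>))"
    unfolding same by (intro sum.cong refl sum_rotations_image inj kernel)
  also have "\<dots> = (\<Sum>\<kappa>\<in>rotations open_ends h0. \<Sum>\<rho>\<in>rotations (closed_ends n) level_vertex.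
      ?g (map_permutation open_ends (place n) \<kappa> \<circ> \<rho>))"
    by (rule sum.swap)
  finally show ?thesis
    by (simp only: partial_sum_def comp_assoc)
qed

text \<open>The two families differ only in how the open ends are grouped into vertices, encoded by
  \<open>h0\<close>, and in the vertex count. By \<open>coarser\<close>, connectedness is inherited
  from the linear chain.\<close>

lemma rational_fraction_family:
  fixes G :: "nat \<Rightarrow> (nat \<times> 'v, nat \<times> 'e) pre_digraph"
  assumes arcs: "\<And>n. n \<ge> 1 \<Longrightarrow> arcs (G n) = {1..n} \<times> arcs H"
    and verts: "\<And>n. n \<ge> 1 \<Longrightarrow> verts (G n) = h n ` ends_upto n"
    and end_vertex: "\<And>n x. n \<ge> 1 \<Longrightarrow> x \<in> ends_upto n \<Longrightarrow> end_vertex (G n) x = h n x"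
    and card: "\<And>n. n \<ge> 1 \<Longrightarrow> card (verts (G n)) + card (arcs (G n)) = C + r * n"
    and coarser: "\<And>n x y. n \<ge> 1 \<Longrightarrow> x \<in> ends_upto n \<Longrightarrow> y \<in> ends_upto n \<Longrightarrow>
      level_vertex x = level_vertex y \<Longrightarrow> h n x = h n y"
    and closed: "\<And>n x. n \<ge> 1 \<Longrightarrow> x \<in> closed_ends n \<Longrightarrow> h n x = level_vertex x"
    and separate: "\<And>n. n \<ge> 1 \<Longrightarrow> h n ` closed_ends n \<inter> h n ` place n ` open_ends = {}"
    and kernel: "\<And>n x y. n \<ge> 1 \<Longrightarrow> x \<in> open_ends \<Longrightarrow> y \<in> open_ends \<Longrightarrow>
      h n (place n x) = h n (place n y) \<longleftrightarrow> h0 x = h0 y"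
  shows "rational_fraction (genus_gf G)"
proof -
  define b where "b n = (\<Sum>\<kappa>\<in>rotations open_ends h0. partial_sum n \<kappa>)" for n
  let ?S = "{\<kappa>. \<kappa> permutes open_ends}"
  \<comment> \<open>The indicator weights turn the sum over all states into the sum over the states
    that close the graph.\<close>
  let ?w = "\<lambda>\<kappa>. if \<kappa> \<in> rotations open_ends h0 then 1 else 0 :: int poly"
  have finS: "finite ?S"
    using finite_open_ends by (rule finite_permutations)
  obtain M where M: "\<forall>\<kappa> n. \<kappa> permutes open_ends \<longrightarrow> n \<ge> 1 \<longrightarrow>
      partial_sum (Suc n) \<kappa> = (\<Sum>\<kappa>'\<in>?S. M \<kappa> \<kappa>' * partial_sum n \<kappa>')"
    using partial_sum_recurrence by (elim exE) (rule that)
  have "\<exists>d c. (\<exists>k\<le>d. c k \<noteq> 0) \<and> (\<forall>n\<ge>1. (\<Sum>k\<le>d. c k * (\<Sum>\<kappa>\<in>?S. ?w \<kappa> * partial_sum (n + k) \<kappa>)) = 0)"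
    by (rule transfer_recurrence[where a = "\<lambda>\<kappa> n. partial_sum n \<kappa>" and M = M, OF finS]) (use M in simp)
  moreover have "(\<Sum>\<kappa>\<in>?S. ?w \<kappa> * partial_sum n \<kappa>) = b n" for n
    unfolding b_def using finS by (intro sum.mono_neutral_cong_right) (auto intro: rotations_permutes)
  ultimately obtain d c where c: "\<exists>k\<le>d. c k \<noteq> 0" and rec: "\<And>n. n \<ge> 1 \<Longrightarrow> (\<Sum>k\<le>d. c k * b (n + k)) = 0"
    by auto
  have "monom 1 2 * b n = monom 1 (C + r * n) * pcompose (genus_poly (G n)) [:0, 0, 1:]" if n: "n \<ge> 1" for n
  proof -
    have ends: "edge_ends (G n) = ends_upto n"
      by (simp add: edge_ends_def ends_upto_def arcs[OF n])
    have flip: "(\<lambda>d. if fst d \<in> arcs (G n) then other_end d else d) = flip n"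
      by (auto simp: fun_eq_iff flip_def ends_upto_def arcs[OF n])
    have rot: "rotations (ends_upto n) (end_vertex (G n)) = rotations (ends_upto n) (h n)"
      by (rule rotations_cong) (simp add: end_vertex[OF n])
    obtain u where "u \<in> U"
      using U_nonempty by blast
    then obtain d where "d \<in> edge_ends H"
      using ex_edge_end U_verts by blast
    then have arcs_ne: "arcs (G n) \<noteq> {}"
      using n by (auto simp: arcs[OF n] edge_ends_def)
    have "monom 1 2 * (\<Sum>\<rho>\<in>rotations (edge_ends (G n)) (end_vertex (G n)).
        monom 1 (transposition_length (edge_ends (G n))
          (\<rho> \<circ> (\<lambda>d. if fst d \<in> arcs (G n) then other_end d else d)))) =
        monom 1 (card (verts (G n)) + card (arcs (G n))) * pcompose (genus_poly (G n)) [:0, 0, 1:]"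
    proof (rule genus_poly_transposition_length)
      show "finite (arcs (G n))"
        by (simp add: arcs[OF n])
      show "end_vertex (G n) ` edge_ends (G n) = verts (G n)"
        unfolding ends verts[OF n] by (rule image_cong[OF refl]) (rule end_vertex[OF n])
    next
      fix T assume T: "T \<subseteq> edge_ends (G n)" "T \<noteq> {}"
        and vertex: "\<And>d d'. d \<in> T \<Longrightarrow> d' \<in> edge_ends (G n) \<Longrightarrow> end_vertex (G n) d = end_vertex (G n) d' \<Longrightarrow> d' \<in> T"
        and edge: "\<And>d. d \<in> T \<Longrightarrow> other_end d \<in> T"
      show "T = edge_ends (G n)"
        unfolding ends
      proof (rule ends_upto_connected)
        fix x y assume xy: "x \<in> T" "y \<in> ends_upto n" "level_vertex x = level_vertex y"
        then have x: "x \<in> ends_upto n"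
          using T(1) ends by blast
        show "y \<in> T"
          by (rule vertex[OF xy(1)])
            (simp_all add: ends xy(2) end_vertex[OF n x] end_vertex[OF n xy(2)] coarser[OF n x xy(2,3)])
      qed (use T ends edge in simp_all)
    qed (rule arcs_ne)
    moreover have "(\<Sum>\<rho>\<in>rotations (ends_upto n) (h n).
        monom 1 (transposition_length (ends_upto n) (\<rho> \<circ> flip n))) = b n"
      unfolding b_def
      by (rule sum_rotations_ends_upto[OF n]) (use n closed separate kernel in simp_all)
    ultimately show ?thesis
      unfolding ends flip rot card[OF n] by (simp only:)
  qed
  then show ?thesis
    unfolding genus_gf_def by (rule rational_fraction_of_transfer[OF _ c rec])
qed

lemma card_arcs_upto: "card ({1..n} \<times> arcs H) = card (arcs H) * n"
  by (simp add: card_cartesian_product)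

lemma rational_linear_family: "rational_fraction (genus_gf (linear_family H U \<phi>))"
proof (rule rational_fraction_family)
  fix n :: nat assume n: "n \<ge> 1"
  have V: "verts (linear_family H U \<phi> n) = {1} \<times> verts H \<union> {2..n} \<times> (verts H - \<phi> ` U)"
    and A: "arcs (linear_family H U \<phi> n) = {1..n} \<times> arcs H"
    using linear_family_structure[of "n - 1"] n by simp_all
  show "arcs (linear_family H U \<phi> n) = {1..n} \<times> arcs H"
    by (rule A)
  show "verts (linear_family H U \<phi> n) = level_vertex ` ends_upto n"
    using level_vertex_image[OF n] by (rule sym)
  show "end_vertex (linear_family H U \<phi> n) x = level_vertex x" if "x \<in> ends_upto n" for x
    using n that by (rule end_vertex_linear_family)
  \<comment> \<open>Each copy contributes its vertices outside \<open>\<phi>\<close>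
    U\<open>, and the first copy also those inside, whence the constant\<close>card (\<phi>
    \<open>U)\<close>.\<close>
  have "card (verts (linear_family H U \<phi> n)) = card (verts H) + (n - 1) * card (verts H - \<phi> ` U)"
    unfolding V by (subst card_Un_disjoint) (auto simp: card_cartesian_product)
  moreover have "card (verts H) = card (\<phi> ` U) + card (verts H - \<phi> ` U)"
    using image_verts by (simp add: card_Diff_subset card_mono finite_subset)
  ultimately show "card (verts (linear_family H U \<phi> n)) + card (arcs (linear_family H U \<phi> n)) =
      card (\<phi> ` U) + (card (verts H - \<phi> ` U) + card (arcs H)) * n"
    unfolding A card_arcs_upto using n by (cases n) (simp_all add: algebra_simps)
  show "level_vertex ` closed_ends n \<inter> level_vertex ` place n ` open_ends = {}"
  proof -
    have "level_vertex x \<noteq> level_vertex (place n y)" if "x \<in> closed_ends n" "y \<in> open_ends" for x y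
    proof
      assume eq: "level_vertex x = level_vertex (place n y)"
      then have "level_vertex x = (if end_vertex H (snd y) \<in> \<phi> ` U then 1 else n, end_vertex H (snd y))"
        using open_vertex[OF n that(2)] by simp
      from closed_vertex(1,3)[OF that(1) this] that(2) show False
        by (auto simp: open_ends_def)
    qed
    then show ?thesis by blast
  qed
  show "level_vertex (place n x) = level_vertex (place n y) \<longleftrightarrow> end_vertex H (snd x) = end_vertex H (snd y)"
    if "x \<in> open_ends" "y \<in> open_ends" for x y
    using open_vertex[OF n that(1)] open_vertex[OF n that(2)] by auto
qed simp_all

lemma rational_circular_family: "rational_fraction (genus_gf (circular_family H U \<phi>))"
proof (rule rational_fraction_family)
  fix n :: nat assume n: "n \<ge> 1"
  have A: "arcs (circular_family H U \<phi> n) = {1..n} \<times> arcs H"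
    using linear_family_structure[of "n - 1"] n by (simp add: circular_family_structure)
  let ?h = "\<lambda>n x. close_up n (level_vertex x)"
  show "arcs (circular_family H U \<phi> n) = {1..n} \<times> arcs H"
    by (rule A)
  show "verts (circular_family H U \<phi> n) = ?h n ` ends_upto n"
    unfolding circular_family_structure level_vertex_image[OF n, symmetric] image_image ..
  show "end_vertex (circular_family H U \<phi> n) x = ?h n x" if "x \<in> ends_upto n" for x
    unfolding circular_family_structure end_vertex_linear_family[OF n that] ..
  show "card (verts (circular_family H U \<phi> n)) + card (arcs (circular_family H U \<phi> n)) =
      0 + (card (verts H - \<phi> ` U) + card (arcs H)) * n"
    by (simp add: A verts_circular_family[OF n] card_cartesian_product algebra_simps)
  show "?h n x = ?h n y" if "level_vertex x = level_vertex y" for x y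
    using that by simp
  have closed: "?h n x = level_vertex x" if "x \<in> closed_ends n" for x
    using closed_vertex(1)[OF that, of "fst (level_vertex x)" "snd (level_vertex x)"]
    by (simp add: close_up_def)
  then show "?h n x = level_vertex x" if "x \<in> closed_ends n" for x
    using that .
  \<comment> \<open>The ends at \<open>u\<close> in the last copy and at \<open>\<phi> u\<close> in
    the first meet at \<open>(n, u)\<close>, so \<open>h0\<close> is \<open>merged U \<phi>\<close>
    applied to the end's vertex.\<close>
  have opened: "?h n (place n y) = (n, merged U \<phi> (end_vertex H (snd y)))" if "y \<in> open_ends" for y
    using open_vertex[OF n that] by (auto simp: close_up_def merged_def)
  have merged_in_U: "merged U \<phi> (end_vertex H (snd y)) \<in> U" if "y \<in> open_ends" for y
    using that inv_in_U by (auto simp: open_ends_def merged_def)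
  show "?h n ` closed_ends n \<inter> ?h n ` place n ` open_ends = {}"
  proof -
    have "?h n x \<noteq> ?h n (place n y)" if "x \<in> closed_ends n" "y \<in> open_ends" for x y
    proof
      assume "?h n x = ?h n (place n y)"
      then have "level_vertex x = (n, merged U \<phi> (end_vertex H (snd y)))"
        using closed[OF that(1)] opened[OF that(2)] by simp
      from closed_vertex(3)[OF that(1) this refl] merged_in_U[OF that(2)] show False
        by simp
    qed
    then show ?thesis by blast
  qed
  show "?h n (place n x) = ?h n (place n y) \<longleftrightarrow>
      merged U \<phi> (end_vertex H (snd x)) = merged U \<phi> (end_vertex H (snd y))"
    if "x \<in> open_ends" "y \<in> open_ends" for x y
    using opened[OF that(1)] opened[OF that(2)] by simp
qed

end

theorem theorem6p6:
  fixes H :: "('v, 'e) pre_digraph"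
    and U\<^sub>1 U\<^sub>2 :: "'v set"
    and \<phi> :: "'v \<Rightarrow> 'v"
  assumes "fin_digraph H"
    and "Digraph_Component.connected H"
    and "U\<^sub>1 \<subseteq> verts H" and "U\<^sub>1 \<noteq> {}"
    and "U\<^sub>2 \<subseteq> verts H" and "U\<^sub>2 \<noteq> {}"
    and "U\<^sub>1 \<inter> U\<^sub>2 = {}"
    and "bij_betw \<phi> U\<^sub>1 U\<^sub>2"
  shows "rational_fraction (genus_gf (linear_family H U\<^sub>1 \<phi>)) \<and>
         rational_fraction (genus_gf (circular_family H U\<^sub>1 \<phi>))"
proof -
  have "\<phi> ` U\<^sub>1 = U\<^sub>2" "inj_on \<phi> U\<^sub>1"
    using assms(8) by (auto simp: bij_betw_def)
  then have "glued_graph H U\<^sub>1 \<phi>"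
    using assms by (auto simp: glued_graph_def glued_graph_axioms_def)
  then show ?thesis
    using glued_graph.rational_linear_family glued_graph.rational_circular_family by blast
qed

end
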